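(* For $n\geq 3$, let $r=r(n)\geq 3$ be an integer and let $\boldsymbol{k}=\boldsymbol{k}(n)=(k_1,\ldots,k_n)$ be a vector of nonnegative integers, where each $k_j=k_j(n)$ may depend on $n$. Let $k_{\max}=k_{\max}(n)=\max_{j=1}^n k_j$, $M=M(n)=\sum_{j=1}^n k_j$ and $M_2=M_2(n)=\sum_{j=1}^n k_j(k_j-1)$ for all $n\geq 3$. Suppose that the set \[ \mathcal{I}=\{n\geq 3 \mid r(n)\text{ divides } M(n)\}\] is infinite, and that $M\to\infty$ and $r^4k_{\max}^4(k_{\max}+r)=o(M)$ as $n$ tends to infinity along elements of $\mathcal{I}$. Then, as $n\to\infty$ along $\mathcal{I}$, the probability that a uniformly random element of $\mathcal{B}_r(\boldsymbol{k})$ has no 4-cycle, and hence has girth at least 6, is \[ \frac{|\mathcal{C}_0|}{|\mathcal{B}_r(\boldsymbol{k})|}=\exp\left(-\frac{(r-1)^2M_2^2}{4M^2}+O\left(\frac{r^4k_{\max}^4(k_{\max}+r)}{M}\right)\right).\]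
   Context: $\mathcal{B}_r(\boldsymbol{k})$ is the set of (simple, labelled) bipartite graphs with vertex bipartition $\{v_1,\ldots,v_n\}\cup\{e_1,\ldots,e_{M/r}\}$ such that $v_j$ has degree $k_j$ for $j=1,\ldots,n$ and every vertex $e_i$ has degree $r$. The vertices $v_j$ are said to be on the left and the vertices $e_i$ on the right. A bipartite graph $B$ has a copy of $K_{a,b}$ if it contains a set of $a$ vertices on the left and $b$ vertices on the right which induce a subgraph isomorphic to $K_{a,b}$. A 4-cycle is a copy of $K_{2,2}$. Let $N_2=3\max\{\lceil\log M\rceil,\ \lceil 2(r-1)^2M_2^2/M^2\rceil\}$. Let $\mathcal{B}_r^{+}(\boldsymbol{k})$ be the set of all $B\in\mathcal{B}_r(\boldsymbol{k})$ such that: (i) $B$ has no copy of $K_{3,2}$ (three vertices on the left, two on the right); (ii) $B$ has no copy of $K_{2,3}$ (two vertices on the left, three on the right); (iii) no two distinct 4-cycles in $B$ have a vertex on the right in common; (iv) any three distinct 4-cycles in $B$ involve at least five vertices on the left; (v) the number of 4-cycles in $B$ is at most $N_2$. $\mathcal{C}_0$ is the set of bipartite graphs in $\mathcal{B}_r^{+}(\boldsymbol{k})$ with no 4-cycles (equivalently, the set of bipartite graphs in $\mathcal{B}_r(\boldsymbol{k})$ with no 4-cycles, since (i)--(v) then hold automatically). A graph with no cycles is regarded as having infinite girth. *)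

theory Defs
  imports "HOL-Probability.Probability" "HOL-Library.Landau_Symbols" "HOL-Library.Extended_Nat"
begin

definition deg_max :: "nat \<Rightarrow> (nat \<Rightarrow> nat) \<Rightarrow> nat" where
  "deg_max n k = Max (k ` {1..n})"

definition deg_sum :: "nat \<Rightarrow> (nat \<Rightarrow> nat) \<Rightarrow> nat" where
  "deg_sum n k = (\<Sum>j=1..n. k j)"

definition deg_sum2 :: "nat \<Rightarrow> (nat \<Rightarrow> nat) \<Rightarrow> nat" where
  "deg_sum2 n k = (\<Sum>j=1..n. k j * (k j - 1))"

text \<open>A bipartite graph is given by its set of edges: \<open>(j, i) \<in> B\<close> means that the left vertex
  \<open>v\<^sub>j\<close> and the right vertex \<open>e\<^sub>i\<close> are adjacent. The two sides are indexed independently, so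
  the index \<open>1\<close>, say, occurs on both sides and denotes two different vertices.\<close>

type_synonym bigraph = "(nat \<times> nat) set"

text \<open>\<open>\<B>\<^sub>r(k)\<close>; only meaningful if \<open>r\<close> divides \<open>deg_sum n k\<close>, as otherwise the number of
  right vertices is rounded down.\<close>

definition bigraphs :: "nat \<Rightarrow> nat \<Rightarrow> (nat \<Rightarrow> nat) \<Rightarrow> bigraph set" where
  "bigraphs n r k = {B. B \<subseteq> {1..n} \<times> {1..deg_sum n k div r} \<and>
     (\<forall>j\<in>{1..n}. card {i. (j, i) \<in> B} = k j) \<and>
     (\<forall>i\<in>{1..deg_sum n k div r}. card {j. (j, i) \<in> B} = r)}"

text \<open>A copy of \<open>K\<^sub>a\<^sub>,\<^sub>b\<close> is identified with its vertex set, split into the left part \<open>X\<close> and the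
  right part \<open>Y\<close>. The subgraph induced by \<open>a\<close> left and \<open>b\<close> right vertices is isomorphic to
  \<open>K\<^sub>a\<^sub>,\<^sub>b\<close> iff all \<open>a * b\<close> possible edges are present. For \<open>a, b > 0\<close> the inclusion
  \<open>X \<times> Y \<subseteq> B\<close> forces \<open>X\<close> and \<open>Y\<close> to consist of vertices of the graph.\<close>

definition copies :: "nat \<Rightarrow> nat \<Rightarrow> bigraph \<Rightarrow> (nat set \<times> nat set) set" where
  "copies a b B = {(X, Y). card X = a \<and> card Y = b \<and> X \<times> Y \<subseteq> B}"

abbreviation has_copy :: "nat \<Rightarrow> nat \<Rightarrow> bigraph \<Rightarrow> bool" where
  "has_copy a b B \<equiv> copies a b B \<noteq> {}"

abbreviation four_cycles :: "bigraph \<Rightarrow> (nat set \<times> nat set) set" where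
  "four_cycles B \<equiv> copies 2 2 B"

definition N2 :: "nat \<Rightarrow> nat \<Rightarrow> (nat \<Rightarrow> nat) \<Rightarrow> int" where
  "N2 n r k = 3 * max \<lceil>ln (real (deg_sum n k))\<rceil>
     \<lceil>2 * (real r - 1)^2 * (real (deg_sum2 n k))^2 / (real (deg_sum n k))^2\<rceil>"

definition bigraphs_plus :: "nat \<Rightarrow> nat \<Rightarrow> (nat \<Rightarrow> nat) \<Rightarrow> bigraph set" where
  "bigraphs_plus n r k = {B \<in> bigraphs n r k.
     \<not> has_copy 3 2 B \<and>
     \<not> has_copy 2 3 B \<and>
     (\<forall>(X, Y)\<in>four_cycles B. \<forall>(X', Y')\<in>four_cycles B. (X, Y) \<noteq> (X', Y') \<longrightarrow> Y \<inter> Y' = {}) \<and>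
     (\<forall>C1\<in>four_cycles B. \<forall>C2\<in>four_cycles B. \<forall>C3\<in>four_cycles B.
        C1 \<noteq> C2 \<and> C1 \<noteq> C3 \<and> C2 \<noteq> C3 \<longrightarrow> card (fst C1 \<union> fst C2 \<union> fst C3) \<ge> 5) \<and>
     int (card (four_cycles B)) \<le> N2 n r k}"

definition C0 :: "nat \<Rightarrow> nat \<Rightarrow> (nat \<Rightarrow> nat) \<Rightarrow> bigraph set" where
  "C0 n r k = {B \<in> bigraphs_plus n r k. four_cycles B = {}}"

text \<open>For the girth, left and right vertices are made disjoint by \<open>Inl\<close> and \<open>Inr\<close>. A cycle is
  the list of its vertices in cyclic order, without repeating the first one at the end.\<close>

definition adjacent :: "bigraph \<Rightarrow> nat + nat \<Rightarrow> nat + nat \<Rightarrow> bool" where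
  "adjacent B u v \<longleftrightarrow>
     (\<exists>j i. (j, i) \<in> B \<and> (u = Inl j \<and> v = Inr i \<or> u = Inr i \<and> v = Inl j))"

definition is_cycle :: "bigraph \<Rightarrow> (nat + nat) list \<Rightarrow> bool" where
  "is_cycle B p \<longleftrightarrow> length p \<ge> 3 \<and> distinct p \<and>
     (\<forall>t<length p. adjacent B (p ! t) (p ! (Suc t mod length p)))"

text \<open>The infimum of the empty set is \<open>\<infinity>\<close> in \<open>enat\<close>.\<close>

definition girth :: "bigraph \<Rightarrow> enat" where
  "girth B = (INF p\<in>{p. is_cycle B p}. enat (length p))"

definition along :: "nat set \<Rightarrow> nat filter" where
  "along I = inf sequentially (principal I)"

end

theory Submission imports Defs begin

text \<open>Let the potential 4-cycles \<open>C\<^sub>1, C\<^sub>2, \<dots>\<close> be enumerated in any order. The probability that none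
  occurs is the product of the factors \<open>1 - p\<^sub>t\<close>, where \<open>p\<^sub>t\<close> is the probability of \<open>C\<^sub>t\<close> given that
  \<open>C\<^sub>1, \<dots>, C\<^sub>t\<^sub>-\<^sub>1\<close> do not occur. To estimate \<open>p\<^sub>t\<close>, the four edges of \<open>C\<^sub>t\<close> are revealed one by one:
  conditionally on the edges \<open>E\<close> and on avoiding any family of 4-cycles, the edge \<open>v\<^sub>j e\<^sub>i\<close> has
  probability \<open>(k\<^sub>j - d\<^sub>E(v\<^sub>j)) (r - d\<^sub>E(e\<^sub>i)) / M\<close> up to a relative error \<open>O(k\<^sub>m\<^sub>a\<^sub>x\<^sup>2 r\<^sup>2 / M)\<close>. This follows
  by exchanging \<open>v\<^sub>j e\<^sub>i, v\<^sub>y e\<^sub>x\<close> for \<open>v\<^sub>j e\<^sub>x, v\<^sub>y e\<^sub>i\<close>. Such a switching is spoiled only by a 3-path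
  between the ends of a new edge. In one direction there are few such switchings in every graph, in
  the other direction there are few on average. Summing \<open>ln (1 - p\<^sub>t)\<close> over all \<open>t\<close> gives the result.\<close>

section \<open>Sums, products and logarithms\<close>

lemma card_Sigma_le:
  assumes "finite A" "card A \<le> c" "\<And>a. a \<in> A \<Longrightarrow> finite (B a)" "\<And>a. a \<in> A \<Longrightarrow> card (B a) \<le> d"
  shows "card (Sigma A B) \<le> c * d"
proof -
  have "card (Sigma A B) = (\<Sum>a\<in>A. card (B a))"
    using assms by (simp add: card_SigmaI)
  also have "\<dots> \<le> card A * d"
    using sum_bounded_above[of A "\<lambda>a. card (B a)" d] assms(4) by simp
  also have "\<dots> \<le> c * d" using assms(2) by simp
  finally show ?thesis .
qed

text \<open>Newton's identity \<open>2 e_2 = p_1^2 - p_2\<close>, used to sum the 4-cycle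
  probabilities over all pairs of left vertices. In the induction step the new subsets are the pairs
  formed by the new element and an old one.\<close>

lemma sum_prod_two_subsets:
  fixes f :: "'a \<Rightarrow> 'b::comm_ring_1"
  assumes "finite A"
  shows "2 * (\<Sum>X | X \<subseteq> A \<and> card X = 2. \<Prod>a\<in>X. f a) = (\<Sum>a\<in>A. f a)^2 - (\<Sum>a\<in>A. (f a)^2)"
  using assms
proof (induction A rule: finite_induct)
  case empty
  have eq: "{X. X \<subseteq> {} \<and> card X = 2} = ({} :: 'a set set)" by auto
  show ?case unfolding eq by simp
next
  case (insert x A)
  let ?P = "\<lambda>A. {X. X \<subseteq> A \<and> card X = 2}"
  have eq: "?P (insert x A) = ?P A \<union> (\<lambda>y. {x, y}) ` A"
  proof (intro equalityI subsetI)
    fix X assume X: "X \<in> ?P (insert x A)"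
    show "X \<in> ?P A \<union> (\<lambda>y. {x, y}) ` A"
    proof (cases "x \<in> X")
      case True
      then obtain y where "X = {x, y}" "x \<noteq> y" using X by (auto simp: card_2_iff)
      then show ?thesis using X by auto
    qed (use X in auto)
  next
    fix X assume "X \<in> ?P A \<union> (\<lambda>y. {x, y}) ` A"
    moreover have "card {x, y} = 2" if "y \<in> A" for y
    proof -
      have "x \<noteq> y" using that insert.hyps by auto
      then show ?thesis by simp
    qed
    ultimately show "X \<in> ?P (insert x A)" by auto
  qed
  have inj: "inj_on (\<lambda>y. {x, y}) A" by (auto simp: inj_on_def doubleton_eq_iff)
  have "(\<Sum>X\<in>?P (insert x A). \<Prod>a\<in>X. f a) = (\<Sum>X\<in>?P A. \<Prod>a\<in>X. f a) + (\<Sum>X\<in>(\<lambda>y. {x, y}) ` A. \<Prod>a\<in>X. f a)"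
    unfolding eq using insert.hyps by (intro sum.union_disjoint) auto
  also have "(\<Sum>X\<in>(\<lambda>y. {x, y}) ` A. \<Prod>a\<in>X. f a) = (\<Sum>y\<in>A. f x * f y)"
    unfolding sum.reindex[OF inj] using insert.hyps by (intro sum.cong refl) (auto intro!: prod.insert[THEN trans])
  also have "\<dots> = f x * (\<Sum>y\<in>A. f y)" by (simp add: sum_distrib_left)
  finally have "2 * (\<Sum>X\<in>?P (insert x A). \<Prod>a\<in>X. f a)
      = 2 * (\<Sum>X\<in>?P A. \<Prod>a\<in>X. f a) + 2 * (f x * (\<Sum>y\<in>A. f y))"
    by (simp add: algebra_simps)
  then show ?case
    unfolding insert.IH using insert.hyps by (simp add: power2_eq_square algebra_simps)
qed

text \<open>Bounds for successive ratios multiply: those collected for \<open>N1 / N0\<close> are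
  extended by one more ratio \<open>N2 / N1\<close> of relative error \<open>t\<close>. The form
  without quotients stays valid when a count is zero.\<close>

lemma chain_bounds:
  fixes l u t A M N0 N1 N2 D :: real
  assumes "l * N0 \<le> A * N1" "A * N1 \<le> u * N0"
    and "(1 - t) * D * N1 \<le> M * N2" "M * N2 \<le> (1 + t) * D * N1"
    and "0 \<le> t" "t \<le> 1" "0 \<le> D" "0 \<le> A"
  shows "(l * ((1 - t) * D)) * N0 \<le> (A * M) * N2" "(A * M) * N2 \<le> (u * ((1 + t) * D)) * N0"
proof -
  have "((1 - t) * D) * (l * N0) \<le> ((1 - t) * D) * (A * N1)"
    using assms by (intro mult_left_mono) auto
  also have "\<dots> = A * ((1 - t) * D * N1)" by (simp add: mult_ac)
  also have "\<dots> \<le> A * (M * N2)" using assms by (intro mult_left_mono) auto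
  finally show "(l * ((1 - t) * D)) * N0 \<le> (A * M) * N2" by (simp add: mult_ac)
  have "A * (M * N2) \<le> A * ((1 + t) * D * N1)" using assms by (intro mult_left_mono) auto
  also have "\<dots> = ((1 + t) * D) * (A * N1)" by (simp add: mult_ac)
  also have "\<dots> \<le> ((1 + t) * D) * (u * N0)" using assms by (intro mult_left_mono) auto
  finally show "(A * M) * N2 \<le> (u * ((1 + t) * D)) * N0" by (simp add: mult_ac)
qed

text \<open>One factor \<open>1 - p\<close> of the product in logarithmic form, with
  \<open>p = N / Z\<close>. The hypotheses give \<open>p \<le> 3/2 q\<close>, so the error in
  \<open>ln (1 - p)\<close> beyond the linear term is at most \<open>2 p^2 \<le> 9/2 q^2\<close>.
  The bound \<open>q \<le> t / 16\<close> makes this at most \<open>t q\<close>, and the error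
  \<open>5 t q\<close> of \<open>p\<close> itself brings the total to \<open>6 t q\<close>.\<close>

lemma abs_ln_minus_ln_le:
  fixes Z N q t :: real
  assumes Z: "0 < Z" and N: "\<bar>N - q * Z\<bar> \<le> 5 * t * q * Z" and t: "t \<le> 1 / 10" and q: "0 \<le> q" "q \<le> t / 16"
  shows "0 < Z - N" "\<bar>ln (Z - N) - ln Z + q\<bar> \<le> 6 * t * q"
proof -
  define p where "p = N / Z"
  have t0: "0 \<le> t" using q by linarith
  have tq: "t * q \<le> 1 / 10 * q" using t q by (intro mult_right_mono) auto
  have "\<bar>p - q\<bar> * Z \<le> (5 * t * q) * Z"
  proof -
    have "\<bar>p - q\<bar> * Z = \<bar>(p - q) * Z\<bar>" using Z by (simp add: abs_mult)
    also have "(p - q) * Z = N - q * Z" using Z by (simp add: p_def field_simps)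
    finally show ?thesis using N by simp
  qed
  then have pq: "\<bar>p - q\<bar> \<le> 5 * t * q" using Z by simp
  then have p: "0 \<le> p" "p \<le> 3 / 2 * q" using tq by linarith+
  have p1: "p \<le> 1 / 2" using p q t by linarith
  have eq: "Z - N = Z * (1 - p)" using Z by (simp add: p_def field_simps)
  show "0 < Z - N" unfolding eq using Z p1 by simp
  have "\<bar>ln (1 + - p) - - p\<bar> \<le> 2 * (- p)^2"
    by (rule abs_ln_one_plus_x_minus_x_bound) (use p p1 in simp)
  also have "2 * (- p)^2 \<le> 2 * (3 / 2 * q)^2" using p by (simp add: power_mono del: power_mult_distrib)
  also have "\<dots> = 9 / 2 * (q * q)" by (simp add: power2_eq_square)
  also have "\<dots> \<le> 9 / 2 * (t / 16 * q)" using q by (intro mult_left_mono mult_right_mono) auto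
  also have "\<dots> \<le> t * q" using t0 q by simp
  finally have "\<bar>ln (1 - p) + p\<bar> \<le> t * q" by simp
  moreover have "ln (Z - N) - ln Z = ln (1 - p)" unfolding eq using Z p1 by (simp add: ln_mult)
  ultimately show "\<bar>ln (Z - N) - ln Z + q\<bar> \<le> 6 * t * q" using pq by linarith
qed

section \<open>Switchings\<close>

definition switch :: "bigraph \<Rightarrow> nat \<Rightarrow> nat \<Rightarrow> nat \<Rightarrow> nat \<Rightarrow> bigraph" where
  "switch G j i y x = G - {(j, i), (y, x)} \<union> {(j, x), (y, i)}"

text \<open>Here \<open>y\<close> and \<open>b\<close> are left vertices, \<open>a\<close> and
  \<open>x\<close> right vertices, visited in the order \<open>y\<close>, \<open>a\<close>,
  \<open>b\<close>, \<open>x\<close>. Such a path closes to a 4-cycle as soon as the edge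
  \<open>(y, x)\<close> is inserted.\<close>

definition path3 :: "bigraph \<Rightarrow> nat \<Rightarrow> nat \<Rightarrow> nat \<Rightarrow> nat \<Rightarrow> bool" where
  "path3 G y x a b \<longleftrightarrow> (y, a) \<in> G \<and> (b, a) \<in> G \<and> (b, x) \<in> G \<and> a \<noteq> x \<and> b \<noteq> y"

text \<open>Reversibility: for a given choice of \<open>j\<close>, \<open>i\<close>,
  \<open>y\<close>, \<open>x\<close> the original graph can be recovered. This is the source of
  injectivity in both double counts.\<close>

lemma switch_switch:
  assumes "(j, i) \<in> G" "(y, x) \<in> G" "(j, x) \<notin> G" "(y, i) \<notin> G"
  shows "switch (switch G j i y x) j x y i = G"
  using assms unfolding switch_def by auto

lemma card_exchange:
  assumes "finite A" "i \<in> A" "x \<notin> A"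
  shows "card (insert x (A - {i})) = card A"
proof -
  have "card A > 0" using assms by (auto simp: card_gt_0_iff)
  then show ?thesis using assms by simp
qed

lemma switch_row_card:
  assumes "(j, i) \<in> G" "(y, x) \<in> G" "(j, x) \<notin> G" "(y, i) \<notin> G" "finite {c. (p, c) \<in> G}"
  shows "card {c. (p, c) \<in> switch G j i y x} = card {c. (p, c) \<in> G}"
proof -
  consider "p = j" | "p = y" "p \<noteq> j" | "p \<noteq> j" "p \<noteq> y" by blast
  then show ?thesis
  proof cases
    case 1
    have "{c. (p, c) \<in> switch G j i y x} = insert x ({c. (p, c) \<in> G} - {i})"
      using assms 1 unfolding switch_def by auto
    then show ?thesis using card_exchange[of "{c. (p, c) \<in> G}" i x] assms 1 by simp
  next
    case 2
    have "{c. (p, c) \<in> switch G j i y x} = insert i ({c. (p, c) \<in> G} - {x})"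
      using assms 2 unfolding switch_def by auto
    then show ?thesis using card_exchange[of "{c. (p, c) \<in> G}" x i] assms 2 by simp
  next
    case 3
    have "{c. (p, c) \<in> switch G j i y x} = {c. (p, c) \<in> G}"
      using assms 3 unfolding switch_def by auto
    then show ?thesis by simp
  qed
qed

text \<open>Transposition swaps the two sides, so the degrees on the right reduce to those on the
  left.\<close>

lemma switch_converse: "(switch G j i y x)\<inverse> = switch (G\<inverse>) x y i j"
  unfolding switch_def by auto

lemma switch_column_card:
  assumes "(j, i) \<in> G" "(y, x) \<in> G" "(j, x) \<notin> G" "(y, i) \<notin> G" "finite {c. (c, p) \<in> G}"
  shows "card {c. (c, p) \<in> switch G j i y x} = card {c. (c, p) \<in> G}"
  using switch_row_card[of x y "G\<inverse>" i j p] assms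
  by (simp flip: switch_converse)

text \<open>Some edge of the rectangle is new. A rectangle with both new edges would also contain
  the removed edge \<open>(j, i)\<close>. Hence the other three edges are old, and they form a
  3-path between the ends of the single new one.\<close>

lemma switch_new_rectangle:
  assumes C: "X \<times> Y \<subseteq> switch G j i y x" "\<not> X \<times> Y \<subseteq> G" "card X = 2" "card Y = 2"
    and G: "(j, i) \<in> G" "(y, x) \<in> G" "(j, x) \<notin> G" "(y, i) \<notin> G"
  shows "(\<exists>a b. path3 (G - {(j, i), (y, x)}) j x a b \<and> X = {j, b} \<and> Y = {a, x}) \<or>
         (\<exists>a b. path3 (G - {(j, i), (y, x)}) y i a b \<and> X = {y, b} \<and> Y = {a, i})"
proof -
  have ne: "j \<noteq> y" "i \<noteq> x" using G by auto
  have no: "(j, i) \<notin> switch G j i y x" "(y, x) \<notin> switch G j i y x"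
    using ne by (auto simp: switch_def)
  have XY: "\<exists>q. q \<noteq> p \<and> X = {p, q}" if "p \<in> X" for p
    using C(3) that by (auto simp: card_2_iff)
  have YY: "\<exists>q. q \<noteq> p \<and> Y = {q, p}" if "p \<in> Y" for p
    using C(4) that by (auto simp: card_2_iff)
  have sub: "X \<times> Y \<subseteq> (G - {(j, i), (y, x)}) \<union> {(j, x), (y, i)}"
    using C(1) by (auto simp: switch_def)
  from C(2) obtain p c where pc: "p \<in> X" "c \<in> Y" "(p, c) \<notin> G" by auto
  then have "(p, c) = (j, x) \<or> (p, c) = (y, i)" using sub by auto
  then show ?thesis
  proof
    assume "(p, c) = (j, x)"
    then obtain a b where ab: "b \<noteq> j" "X = {j, b}" "a \<noteq> x" "Y = {a, x}"
      using XY[of j] YY[of x] pc by auto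
    have "(j, a) \<in> X \<times> Y" "(b, a) \<in> X \<times> Y" "(b, x) \<in> X \<times> Y" using ab by auto
    moreover have "(y, i) \<notin> X \<times> Y"
    proof
      assume "(y, i) \<in> X \<times> Y"
      then have "(j, i) \<in> X \<times> Y" using ab by auto
      then show False using C(1) no by auto
    qed
    ultimately have "path3 (G - {(j, i), (y, x)}) j x a b"
      using sub ab unfolding path3_def by auto
    then show ?thesis using ab by blast
  next
    assume "(p, c) = (y, i)"
    then obtain a b where ab: "b \<noteq> y" "X = {y, b}" "a \<noteq> i" "Y = {a, i}"
      using XY[of y] YY[of i] pc by auto
    have "(y, a) \<in> X \<times> Y" "(b, a) \<in> X \<times> Y" "(b, i) \<in> X \<times> Y" using ab by auto
    moreover have "(j, x) \<notin> X \<times> Y"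
    proof
      assume "(j, x) \<in> X \<times> Y"
      then have "(j, i) \<in> X \<times> Y" using ab by auto
      then show False using C(1) no by auto
    qed
    ultimately have "path3 (G - {(j, i), (y, x)}) y i a b"
      using sub ab unfolding path3_def by auto
    then show ?thesis using ab by blast
  qed
qed

section \<open>Graphs with given degrees, and switchings counted in every graph\<close>

locale degree_sequence =
  fixes n m r K :: nat and k :: "nat \<Rightarrow> nat"
  assumes sum_k: "(\<Sum>j=1..n. k j) = m * r"
    and k_le: "\<And>j. j \<in> {1..n} \<Longrightarrow> k j \<le> K"
    and r_ge: "3 \<le> r"
    and K_ge: "1 \<le> K"
begin

definition rects :: "(nat set \<times> nat set) set" where
  "rects = {X. X \<subseteq> {1..n} \<and> card X = 2} \<times> {Y. Y \<subseteq> {1..m} \<and> card Y = 2}"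

text \<open>\<open>S\<close> collects the 4-cycles excluded so far and \<open>E\<close> the edges
  revealed so far. Quotients of the cardinalities of these sets are the conditional probabilities to
  be estimated.\<close>

definition graphs :: "(nat set \<times> nat set) set \<Rightarrow> bigraph \<Rightarrow> bigraph set" where
  "graphs S E = {G \<in> bigraphs n r k. E \<subseteq> G \<and> (\<forall>(X, Y)\<in>S. \<not> X \<times> Y \<subseteq> G)}"

lemma deg_sum_div: "deg_sum n k div r = m"
  using sum_k r_ge by (simp add: deg_sum_def)

lemma bigraphs_eq: "bigraphs n r k = {B. B \<subseteq> {1..n} \<times> {1..m} \<and>
     (\<forall>j\<in>{1..n}. card {i. (j, i) \<in> B} = k j) \<and>
     (\<forall>i\<in>{1..m}. card {j. (j, i) \<in> B} = r)}"
  unfolding bigraphs_def deg_sum_div ..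

lemma finite_bigraphs: "finite (bigraphs n r k)"
  by (rule finite_subset[of _ "Pow ({1..n} \<times> {1..m})"]) (auto simp: bigraphs_eq)

lemma finite_graphs: "finite (graphs S E)"
  using finite_bigraphs unfolding graphs_def by auto

lemma finite_rects: "finite rects"
  unfolding rects_def by auto

lemma graph_finite:
  assumes "G \<in> bigraphs n r k"
  shows "finite G"
  by (rule finite_subset[of _ "{1..n} \<times> {1..m}"]) (use assms in \<open>auto simp: bigraphs_eq\<close>)

lemma row_finite:
  assumes "G \<in> bigraphs n r k"
  shows "finite {i. (j, i) \<in> G}"
  by (rule finite_subset[of _ "{1..m}"]) (use assms in \<open>auto simp: bigraphs_eq\<close>)

lemma column_finite:
  assumes "G \<in> bigraphs n r k"
  shows "finite {j. (j, i) \<in> G}"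
  by (rule finite_subset[of _ "{1..n}"]) (use assms in \<open>auto simp: bigraphs_eq\<close>)

lemma row_le:
  assumes "G \<in> bigraphs n r k"
  shows "card {i. (j, i) \<in> G} \<le> K"
proof (cases "j \<in> {1..n}")
  case True
  then show ?thesis using assms k_le by (auto simp: bigraphs_eq)
next
  case False
  then have "{i. (j, i) \<in> G} = {}" using assms by (auto simp: bigraphs_eq)
  then show ?thesis by (metis card.empty le0)
qed

lemma column_le:
  assumes "G \<in> bigraphs n r k"
  shows "card {j. (j, i) \<in> G} \<le> r"
proof (cases "i \<in> {1..m}")
  case True
  then show ?thesis using assms by (auto simp: bigraphs_eq)
next
  case False
  then have "{j. (j, i) \<in> G} = {}" using assms by (auto simp: bigraphs_eq)
  then show ?thesis by (metis card.empty le0)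
qed

lemma graph_card:
  assumes "G \<in> bigraphs n r k"
  shows "card G = m * r"
proof -
  have "G = Sigma {1..n} (\<lambda>j. {i. (j, i) \<in> G})" using assms by (auto simp: bigraphs_eq)
  then have "card G = card (Sigma {1..n} (\<lambda>j. {i. (j, i) \<in> G}))" by simp
  also have "\<dots> = (\<Sum>j=1..n. card {i. (j, i) \<in> G})"
    using row_finite[OF assms] by (simp add: card_SigmaI)
  also have "\<dots> = (\<Sum>j=1..n. k j)" using assms by (intro sum.cong) (auto simp: bigraphs_eq)
  also have "\<dots> = m * r" by (rule sum_k)
  finally show ?thesis .
qed

lemma switch_bigraph:
  assumes B: "G \<in> bigraphs n r k" and G: "(j, i) \<in> G" "(y, x) \<in> G" "(j, x) \<notin> G" "(y, i) \<notin> G"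
  shows "switch G j i y x \<in> bigraphs n r k"
proof -
  have "switch G j i y x \<subseteq> {1..n} \<times> {1..m}"
    using B G(1,2) unfolding bigraphs_eq switch_def by blast
  then show ?thesis
    using B switch_row_card[OF G row_finite[OF B]] switch_column_card[OF G column_finite[OF B]]
    by (simp add: bigraphs_eq)
qed

text \<open>These are the edges \<open>(y, x)\<close> that are unsuitable for a switching with
  \<open>(j, i)\<close>. Each is in \<open>E\<close> or is reached by a walk from \<open>j\<close>
  or \<open>i\<close>, with at most \<open>K\<close> continuations at a left vertex and
  \<open>r\<close> at a right one: this yields \<open>K r\<close> edges for each of the two
  adjacency conditions and \<open>(K r)^2\<close> for each of the two kinds of 3-paths.\<close>

lemma card_bad_edges:
  assumes B: "G \<in> bigraphs n r k" and E: "card E \<le> 9" "finite E"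
  shows "card {(y, x) \<in> G. (y, x) \<in> E \<or> (j, x) \<in> G \<or> (y, i) \<in> G \<or>
     (\<exists>a b. path3 G j x a b) \<or> (\<exists>a b. path3 G y i a b)} \<le> 5 * (K * r)^2"
    (is "card ?A \<le> _")
proof -
  let ?R = "\<lambda>j. {i. (j, i) \<in> G}" and ?L = "\<lambda>i. {j. (j, i) \<in> G}"
  let ?S1 = "SIGMA x:?R j. ?L x" and ?S2 = "SIGMA y:?L i. ?R y"
  let ?S3 = "SIGMA a:?R j. SIGMA b:?L a. SIGMA x:?R b. ?L x"
  let ?S4 = "SIGMA b:?L i. SIGMA a:?R b. SIGMA y:?L a. ?R y"
  note fin = row_finite[OF B] column_finite[OF B]
  note le = row_le[OF B] column_le[OF B]
  have f: "finite ?S1" "finite ?S2" "finite ?S3" "finite ?S4"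
    using fin by (auto intro!: finite_SigmaI)
  have c: "card ?S1 \<le> K * r" "card ?S2 \<le> r * K"
     "card ?S3 \<le> K * (r * (K * r))" "card ?S4 \<le> r * (K * (r * K))"
    by (intro card_Sigma_le finite_SigmaI fin le)+
  have sub: "?A \<subseteq> E \<union> (\<lambda>(x, y). (y, x)) ` ?S1 \<union> ?S2 \<union> (\<lambda>(a, b, x, y). (y, x)) ` ?S3
      \<union> (\<lambda>(b, a, y, x). (y, x)) ` ?S4"
  proof
    fix p assume "p \<in> ?A"
    then obtain y x where p: "p = (y, x)" "(y, x) \<in> G" and
      "(y, x) \<in> E \<or> (j, x) \<in> G \<or> (y, i) \<in> G \<or>
     (\<exists>a b. path3 G j x a b) \<or> (\<exists>a b. path3 G y i a b)" by blast
    then consider "(y, x) \<in> E" | "(j, x) \<in> G" | "(y, i) \<in> G" | a b where "path3 G j x a b"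
      | a b where "path3 G y i a b" by blast
    then show "p \<in> E \<union> (\<lambda>(x, y). (y, x)) ` ?S1 \<union> ?S2 \<union> (\<lambda>(a, b, x, y). (y, x)) ` ?S3
      \<union> (\<lambda>(b, a, y, x). (y, x)) ` ?S4"
    proof cases
      case 2
      then have "(x, y) \<in> ?S1" using p by auto
      then show ?thesis using p(1) by force
    next
      case (4 a b)
      then have "(a, b, x, y) \<in> ?S3" using p by (auto simp: path3_def)
      then show ?thesis using p(1) by force
    next
      case (5 a b)
      then have "(b, a, y, x) \<in> ?S4" using p by (auto simp: path3_def)
      then show ?thesis using p(1) by force
    qed (use p in auto)
  qed
  have "card ?A \<le> card (E \<union> (\<lambda>(x, y). (y, x)) ` ?S1 \<union> ?S2 \<union> (\<lambda>(a, b, x, y). (y, x)) ` ?S3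
      \<union> (\<lambda>(b, a, y, x). (y, x)) ` ?S4)"
    by (rule card_mono[OF _ sub]) (use f E in auto)
  also have "\<dots> \<le> card E + card ?S1 + card ?S2 + card ?S3 + card ?S4"
    by (intro order_trans[OF card_Un_le] add_mono card_image_le f order_refl)
  also have "\<dots> \<le> 9 + K * r + r * K + K * (r * (K * r)) + r * (K * (r * K))"
    using c E by linarith
  also have "\<dots> = 9 + 2 * (K * r) + 2 * (K * r)^2"
    by (simp add: power2_eq_square algebra_simps)
  \<comment> \<open>Since \<open>K r \<ge> 3\<close>, the lower terms are absorbed; in particular
    the bound 9 on \<open>card E\<close> is at most \<open>(K r)^2\<close>.\<close>
  also have "\<dots> \<le> 5 * (K * r)^2"
  proof -
    have "1 * 3 \<le> K * r" using K_ge r_ge by (intro mult_mono) auto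
    then have "3 * 3 \<le> (K * r) * (K * r)" "3 * (K * r) \<le> (K * r) * (K * r)"
      by (intro mult_mono; simp)+
    then show ?thesis unfolding power2_eq_square by linarith
  qed
  finally show ?thesis .
qed

text \<open>These pairs are the candidates for a reverse switching that creates
  \<open>(j, i)\<close>. Because \<open>E\<close> is contained in every graph considered, their
  number is the same for all of them, so that summing over graphs is exact.\<close>

lemma card_pairs:
  assumes G: "G \<in> graphs S E" and j: "j \<in> {1..n}" "i \<in> {1..m}"
  shows "card (({x. (j, x) \<in> G} - {x. (j, x) \<in> E}) \<times> ({y. (y, i) \<in> G} - {y. (y, i) \<in> E}))
       = (k j - card {x. (j, x) \<in> E}) * (r - card {y. (y, i) \<in> E})"
proof -
  have B: "G \<in> bigraphs n r k" and sub: "E \<subseteq> G" using G by (auto simp: graphs_def)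
  have "card ({x. (j, x) \<in> G} - {x. (j, x) \<in> E}) = k j - card {x. (j, x) \<in> E}"
    using B j sub row_finite[OF B, of j]
    by (subst card_Diff_subset) (auto simp: bigraphs_eq intro: finite_subset)
  moreover have "card ({y. (y, i) \<in> G} - {y. (y, i) \<in> E}) = r - card {y. (y, i) \<in> E}"
    using B j sub column_finite[OF B, of i]
    by (subst card_Diff_subset) (auto simp: bigraphs_eq intro: finite_subset)
  ultimately show ?thesis by (simp add: card_cartesian_product)
qed

lemma card_Sigma_pairs:
  assumes A: "A \<subseteq> graphs S E" and j: "j \<in> {1..n}" "i \<in> {1..m}"
  shows "card (SIGMA G:A. ({x. (j, x) \<in> G} - {x. (j, x) \<in> E}) \<times> ({y. (y, i) \<in> G} - {y. (y, i) \<in> E}))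
       = card A * ((k j - card {x. (j, x) \<in> E}) * (r - card {y. (y, i) \<in> E}))"
proof -
  have fin: "finite A" using A finite_graphs finite_subset by blast
  have B: "G \<in> bigraphs n r k" if "G \<in> A" for G using A that by (auto simp: graphs_def)
  have "card (SIGMA G:A. ({x. (j, x) \<in> G} - {x. (j, x) \<in> E}) \<times> ({y. (y, i) \<in> G} - {y. (y, i) \<in> E}))
     = (\<Sum>G\<in>A. card (({x. (j, x) \<in> G} - {x. (j, x) \<in> E}) \<times> ({y. (y, i) \<in> G} - {y. (y, i) \<in> E})))"
    using fin row_finite[OF B] column_finite[OF B]
    by (intro card_SigmaI) auto
  also have "\<dots> = (\<Sum>G\<in>A. (k j - card {x. (j, x) \<in> E}) * (r - card {y. (y, i) \<in> E}))"
    using A j by (intro sum.cong refl card_pairs[where S=S]) auto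
  finally show ?thesis by simp
qed

text \<open>Double counting of the switchings that remove \<open>(j, i)\<close>. By
  \<open>card_bad_edges\<close>, a graph with this edge admits at least
  \<open>m r - 5 (K r)^2\<close> of them. In the resulting graph \<open>x\<close> is joined to
  \<open>j\<close> and \<open>y\<close> to \<open>i\<close> by edges outside \<open>E\<close>, which
  limits the possible origins.\<close>

lemma switch_upper:
  assumes e: "(j, i) \<notin> E" "j \<in> {1..n}" "i \<in> {1..m}" and E: "card E \<le> 9" "finite E"
    and S: "S \<subseteq> rects"
  shows "card (graphs S (insert (j, i) E)) * (m * r - 5 * (K * r)^2)
    \<le> card (graphs S E) * ((k j - card {x. (j, x) \<in> E}) * (r - card {y. (y, i) \<in> E}))"
proof -
  define bad where "bad = (\<lambda>G. {(y, x) \<in> G. (y, x) \<in> E \<or> (j, x) \<in> G \<or> (y, i) \<in> G \<or>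
     (\<exists>a b. path3 G j x a b) \<or> (\<exists>a b. path3 G y i a b)})"
  define P where "P = (SIGMA G:graphs S (insert (j, i) E). G - bad G)"
  define Q where "Q = (SIGMA G:graphs S E.
     ({x. (j, x) \<in> G} - {x. (j, x) \<in> E}) \<times> ({y. (y, i) \<in> G} - {y. (y, i) \<in> E}))"
  have B: "G \<in> bigraphs n r k" if "G \<in> graphs S E'" for G E' using that by (auto simp: graphs_def)
  have bad_le: "m * r - 5 * (K * r)^2 \<le> card (G - bad G)" if "G \<in> graphs S (insert (j, i) E)" for G
  proof -
    have "card (G - bad G) \<ge> card G - card (bad G)"
      using graph_finite[OF B[OF that]] by (intro diff_card_le_card_Diff) (auto simp: bad_def intro: finite_subset)
    moreover have "card (bad G) \<le> 5 * (K * r)^2"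
      unfolding bad_def by (rule card_bad_edges[OF B[OF that] E])
    ultimately show ?thesis using graph_card[OF B[OF that]] by linarith
  qed
  have "card (graphs S (insert (j, i) E)) * (m * r - 5 * (K * r)^2)
      \<le> (\<Sum>G\<in>graphs S (insert (j, i) E). card (G - bad G))"
    using sum_bounded_below[of "graphs S (insert (j, i) E)", OF bad_le] by simp
  also have "\<dots> = card P"
    unfolding P_def using graph_finite[OF B] finite_graphs by (subst card_SigmaI) auto
  also have "\<dots> \<le> card Q"
  proof (rule card_inj_on_le)
    let ?f = "\<lambda>(G, y, x). (switch G j i y x, x, y)"
    have P: "G \<in> bigraphs n r k" "E \<subseteq> G" "(j, i) \<in> G" "(y, x) \<in> G" "(y, x) \<notin> E" "(j, x) \<notin> G" "(y, i) \<notin> G"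
        "\<And>X Y. (X, Y) \<in> S \<Longrightarrow> \<not> X \<times> Y \<subseteq> G"
        "\<And>a b. \<not> path3 G j x a b" "\<And>a b. \<not> path3 G y i a b" if "(G, y, x) \<in> P" for G y x
      using that unfolding P_def bad_def graphs_def by auto
    show "inj_on ?f P"
    proof (rule inj_onI)
      fix p q assume pq: "p \<in> P" "q \<in> P" "?f p = ?f q"
      obtain G y x where p: "p = (G, y, x)" by (cases p)
      obtain G' where q: "q = (G', y, x)" using pq(3) p by (cases q) auto
      have "switch G j i y x = switch G' j i y x" using pq(3) p q by simp
      then have "switch (switch G j i y x) j x y i = switch (switch G' j i y x) j x y i" by simp
      then show "p = q"
        using switch_switch[OF P(3,4,6,7)] pq p q by metis
    qed
    show "?f ` P \<subseteq> Q"
    proof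
      fix q assume "q \<in> ?f ` P"
      then obtain G y x where q: "q = (switch G j i y x, x, y)" and p: "(G, y, x) \<in> P" by auto
      note P = P[OF p]
      \<comment> \<open>A rectangle of \<open>S\<close> could arise only from a 3-path between the
        ends of a new edge, and such choices of \<open>(y, x)\<close> were discarded as bad.\<close>
      have "\<not> X \<times> Y \<subseteq> switch G j i y x" if "(X, Y) \<in> S" for X Y
      proof
        assume "X \<times> Y \<subseteq> switch G j i y x"
        moreover have "card X = 2" "card Y = 2" using that S by (auto simp: rects_def)
        ultimately have "\<exists>a b. path3 (G - {(j, i), (y, x)}) j x a b \<or> path3 (G - {(j, i), (y, x)}) y i a b"
          using switch_new_rectangle[OF _ P(8)[OF that] _ _ P(3,4,6,7)] by blast
        then show False using P(9,10) by (auto simp: path3_def)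
      qed
      moreover have "E \<subseteq> switch G j i y x" using P e(1) by (auto simp: switch_def)
      ultimately have "switch G j i y x \<in> graphs S E"
        using switch_bigraph[OF P(1,3,4,6,7)] by (auto simp: graphs_def)
      moreover have "(j, x) \<in> switch G j i y x" "(y, i) \<in> switch G j i y x" by (auto simp: switch_def)
      moreover have "(j, x) \<notin> E" "(y, i) \<notin> E" using P by auto
      ultimately show "q \<in> Q" unfolding Q_def q by auto
    qed
    show "finite Q"
      unfolding Q_def using finite_graphs row_finite[OF B] column_finite[OF B] by (intro finite_SigmaI) auto
  qed
  also have "card Q = card (graphs S E) * ((k j - card {x. (j, x) \<in> E}) * (r - card {y. (y, i) \<in> E}))"
    unfolding Q_def by (rule card_Sigma_pairs[OF order_refl e(2,3)])
  finally show ?thesis .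
qed

end

section \<open>The probability of a given 4-cycle\<close>

text \<open>The constant 160 is chosen so that the relative error
  \<open>\<theta> = 16 (K r)^2 / (m r)\<close> of a single edge is at most
  \<open>1 / 10\<close>.\<close>

locale sparse_degree_sequence = degree_sequence +
  assumes sparse: "160 * (K * r)^2 \<le> m * r"
begin

definition \<rho> :: real where "\<rho> = 2 * real (K * r) / real (m * r)"

lemma Kr_ge: "3 \<le> K * r"
  using mult_mono[of 1 K 3 r] K_ge r_ge by simp

lemma mr_pos: "0 < m * r"
proof -
  have "0 < 160 * (K * r)^2" using K_ge r_ge by simp
  then show ?thesis using sparse by linarith
qed

lemma \<rho>_nonneg: "0 \<le> \<rho>"
  by (simp add: \<rho>_def)

text \<open>A crude bound, used to show that spoiled switchings are rare. There are at most
  \<open>K r\<close> reverse switchings per graph, and \<open>5 (K r)^2\<close> is at most half of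
  \<open>m r\<close>, whence the factor 2 in \<open>\<rho>\<close>.\<close>

lemma edge_upper:
  assumes e: "e \<notin> E" and E: "card E \<le> 9" "finite E"
    and S: "S \<subseteq> rects"
  shows "real (card (graphs S (insert e E))) \<le> \<rho> * real (card (graphs S E))"
proof (cases "e \<in> {1..n} \<times> {1..m}")
  case False
  then have "graphs S (insert e E) = {}" by (auto simp: graphs_def bigraphs_eq)
  then show ?thesis using \<rho>_nonneg by simp
next
  case True
  then obtain j i where ji: "e = (j, i)" "j \<in> {1..n}" "i \<in> {1..m}" by auto
  let ?N = "card (graphs S E)" and ?N' = "card (graphs S (insert e E))"
  have "?N' * (m * r - 5 * (K * r)^2) \<le> ?N * ((k j - card {x. (j, x) \<in> E}) * (r - card {y. (y, i) \<in> E}))"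
    using switch_upper[of j i E S] e E S ji by simp
  also have "\<dots> \<le> ?N * (K * r)"
    using k_le[OF ji(2)] by (intro mult_mono order_refl) auto
  finally have "?N' * (m * r - 5 * (K * r)^2) \<le> ?N * (K * r)" .
  moreover have "m * r \<le> 2 * (m * r - 5 * (K * r)^2)" using sparse by linarith
  ultimately have "?N' * (m * r) \<le> 2 * (?N * (K * r))"
    using mult_left_mono[of "m * r" "2 * (m * r - 5 * (K * r)^2)" ?N'] by linarith
  then have "real ?N' * real (m * r) \<le> 2 * (real ?N * real (K * r))"
    by (metis of_nat_le_iff of_nat_mult of_nat_numeral)
  then show ?thesis using mr_pos by (simp add: \<rho>_def field_simps)
qed

section \<open>Rarity of 3-paths between two given vertices\<close>

lemma graphs_Un: "graphs S (E \<union> F) = {G \<in> graphs S E. F \<subseteq> G}"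
  by (auto simp: graphs_def)

lemma sum_card_graphs:
  assumes "finite P"
  shows "(\<Sum>p\<in>P. card (graphs S (E \<union> F p))) = (\<Sum>G\<in>graphs S E. card {p \<in> P. F p \<subseteq> G})"
  unfolding graphs_Un by (rule sum_multicount_gen[OF assms finite_graphs]) simp

text \<open>For each configuration \<open>p\<close> the edges \<open>F p\<close> are revealed first;
  then the last edge \<open>e p\<close> costs a factor \<open>\<rho>\<close>. Summing over
  \<open>p\<close>, the average number of indices with \<open>F p\<close> present appears, and it is
  at most \<open>D\<close> because this holds in every graph.\<close>

lemma union_bound:
  assumes P: "finite P" and e: "\<And>p. p \<in> P \<Longrightarrow> e p \<notin> E \<union> F p"
    and F: "\<And>p. p \<in> P \<Longrightarrow> finite (F p)" "\<And>p. p \<in> P \<Longrightarrow> card (F p) \<le> 2"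
    and E: "finite E" "card E \<le> 5" and S: "S \<subseteq> rects"
    and D: "\<And>G. G \<in> graphs S E \<Longrightarrow> card {p \<in> P. F p \<subseteq> G} \<le> D"
  shows "real (card {G \<in> graphs S E. \<exists>p\<in>P. insert (e p) (F p) \<subseteq> G})
    \<le> \<rho> * real D * real (card (graphs S E))"
proof -
  have "{G \<in> graphs S E. \<exists>p\<in>P. insert (e p) (F p) \<subseteq> G} = (\<Union>p\<in>P. graphs S (insert (e p) (E \<union> F p)))"
    by (auto simp: graphs_def)
  then have "real (card {G \<in> graphs S E. \<exists>p\<in>P. insert (e p) (F p) \<subseteq> G})
    \<le> real (\<Sum>p\<in>P. card (graphs S (insert (e p) (E \<union> F p))))"
    using card_UN_le[OF P, of "\<lambda>p. graphs S (insert (e p) (E \<union> F p))"] by (simp only: of_nat_le_iff)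
  then have "real (card {G \<in> graphs S E. \<exists>p\<in>P. insert (e p) (F p) \<subseteq> G})
    \<le> (\<Sum>p\<in>P. real (card (graphs S (insert (e p) (E \<union> F p)))))"
    by (simp only: of_nat_sum)
  also have "\<dots> \<le> (\<Sum>p\<in>P. \<rho> * real (card (graphs S (E \<union> F p))))"
  proof (rule sum_mono)
    fix p assume p: "p \<in> P"
    have "card (E \<union> F p) \<le> 9" using card_Un_le[of E "F p"] F(2)[OF p] E(2) by linarith
    then show "real (card (graphs S (insert (e p) (E \<union> F p)))) \<le> \<rho> * real (card (graphs S (E \<union> F p)))"
      using edge_upper[OF e[OF p] _ _ S] F(1)[OF p] E(1) by simp
  qed
  also have "\<dots> = \<rho> * real (\<Sum>p\<in>P. card (graphs S (E \<union> F p)))"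
    by (simp add: sum_distrib_left)
  also have "\<dots> = \<rho> * real (\<Sum>G\<in>graphs S E. card {p \<in> P. F p \<subseteq> G})"
    by (simp only: sum_card_graphs[OF P])
  also have "\<dots> \<le> \<rho> * real (card (graphs S E) * D)"
    using sum_bounded_above[of "graphs S E", OF D] \<rho>_nonneg
    by (intro mult_left_mono) (simp_all only: of_nat_le_iff of_nat_id)
  finally show ?thesis by (simp add: mult_ac)
qed

text \<open>Paths lying entirely in \<open>E\<close> occur in every graph containing
  \<open>E\<close>; only the remaining ones can be rare.\<close>

definition has_path :: "bigraph \<Rightarrow> nat \<Rightarrow> nat \<Rightarrow> bigraph \<Rightarrow> bool" where
  "has_path E y x G \<longleftrightarrow> (\<exists>a b. path3 G y x a b \<and> \<not> {(y, a), (b, a), (b, x)} \<subseteq> E)"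

text \<open>Some edge of the path lies outside \<open>E\<close>. In each of the three cases
  \<open>union_bound\<close> is applied with that edge as the last one; the other two edges can be
  chosen in at most \<open>K r\<close> ways in any graph.\<close>

lemma path_bound:
  assumes E: "finite E" "card E \<le> 5" and S: "S \<subseteq> rects"
  shows "real (card {G \<in> graphs S E. has_path E y x G})
    \<le> 3 * \<rho> * real (K * r) * real (card (graphs S E))"
proof -
  let ?T = "\<lambda>P e F. {G \<in> graphs S E. \<exists>p\<in>P. insert (e p) (F p) \<subseteq> G}"
  define Q where "Q = {(a, b). (a, b) \<in> {1..m} \<times> {1..n} \<and> a \<noteq> x \<and> b \<noteq> y}"
  define e1 F1 e2 F2 e3 F3 where defs:
    "e1 = (\<lambda>(a::nat, b::nat). (y, a))" "F1 = (\<lambda>(a::nat, b::nat). {(b, a), (b, x)})"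
    "e2 = (\<lambda>(a::nat, b::nat). (b, a))" "F2 = (\<lambda>(a::nat, b::nat). {(y, a), (b, x)})"
    "e3 = (\<lambda>(a::nat, b::nat). (b, x))" "F3 = (\<lambda>(a::nat, b::nat). {(y, a), (b, a)})"
  define P1 P2 P3 where P: "P1 = {p \<in> Q. e1 p \<notin> E}" "P2 = {p \<in> Q. e2 p \<notin> E}" "P3 = {p \<in> Q. e3 p \<notin> E}"
  have B: "G \<in> bigraphs n r k" if "G \<in> graphs S E" for G using that by (auto simp: graphs_def)
  have fin: "finite Q" unfolding Q_def by (rule finite_subset[of _ "{1..m} \<times> {1..n}"]) auto
  have sub: "{G \<in> graphs S E. has_path E y x G} \<subseteq> ?T P1 e1 F1 \<union> ?T P2 e2 F2 \<union> ?T P3 e3 F3"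
  proof
    fix G assume "G \<in> {G \<in> graphs S E. has_path E y x G}"
    then obtain a b where G: "G \<in> graphs S E" and ab: "path3 G y x a b" "\<not> {(y, a), (b, a), (b, x)} \<subseteq> E"
      by (auto simp: has_path_def)
    have "(a, b) \<in> Q" using B[OF G] ab by (auto simp: Q_def path3_def bigraphs_eq)
    with ab have "(a, b) \<in> P1 \<or> (a, b) \<in> P2 \<or> (a, b) \<in> P3" by (auto simp: P defs)
    moreover have "insert (e1 (a, b)) (F1 (a, b)) \<subseteq> G" "insert (e2 (a, b)) (F2 (a, b)) \<subseteq> G"
      "insert (e3 (a, b)) (F3 (a, b)) \<subseteq> G" using ab(1) by (auto simp: path3_def defs)
    ultimately show "G \<in> ?T P1 e1 F1 \<union> ?T P2 e2 F2 \<union> ?T P3 e3 F3" using G by blast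
  qed
  have card2: "card {u, v} \<le> 2" for u v :: "nat \<times> nat" by (simp add: card_insert_if)
  have T1: "real (card (?T P1 e1 F1)) \<le> \<rho> * real (r * K) * real (card (graphs S E))"
  proof (rule union_bound[OF _ _ _ _ E S])
    fix G assume G: "G \<in> graphs S E"
    let ?W = "SIGMA b:{b. (b, x) \<in> G}. {a. (b, a) \<in> G}"
    have "{p \<in> P1. F1 p \<subseteq> G} \<subseteq> (\<lambda>(b, a). (a, b)) ` ?W"
      by (auto simp: defs)
    moreover have f: "finite ?W" using row_finite[OF B[OF G]] column_finite[OF B[OF G]] by auto
    ultimately have "card {p \<in> P1. F1 p \<subseteq> G} \<le> card ?W"
      using surj_card_le by blast
    also have "\<dots> \<le> r * K"
      by (intro card_Sigma_le row_finite column_finite row_le column_le B G)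
    finally show "card {p \<in> P1. F1 p \<subseteq> G} \<le> r * K" .
  qed (use fin card2 in \<open>auto simp: P defs Q_def\<close>)
  have T2: "real (card (?T P2 e2 F2)) \<le> \<rho> * real (K * r) * real (card (graphs S E))"
  proof (rule union_bound[OF _ _ _ _ E S])
    fix G assume G: "G \<in> graphs S E"
    let ?W = "{a. (y, a) \<in> G} \<times> {b. (b, x) \<in> G}"
    have "{p \<in> P2. F2 p \<subseteq> G} \<subseteq> ?W"
      by (auto simp: defs)
    moreover have f: "finite ?W" using row_finite[OF B[OF G]] column_finite[OF B[OF G]] by auto
    ultimately have "card {p \<in> P2. F2 p \<subseteq> G} \<le> card ?W"
      using card_mono by blast
    also have "\<dots> \<le> K * r"
      by (intro card_Sigma_le row_finite column_finite row_le column_le B G)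
    finally show "card {p \<in> P2. F2 p \<subseteq> G} \<le> K * r" .
  qed (use fin card2 in \<open>auto simp: P defs Q_def\<close>)
  have T3: "real (card (?T P3 e3 F3)) \<le> \<rho> * real (K * r) * real (card (graphs S E))"
  proof (rule union_bound[OF _ _ _ _ E S])
    fix G assume G: "G \<in> graphs S E"
    let ?W = "SIGMA a:{a. (y, a) \<in> G}. {b. (b, a) \<in> G}"
    have "{p \<in> P3. F3 p \<subseteq> G} \<subseteq> ?W"
      by (auto simp: defs)
    moreover have f: "finite ?W" using row_finite[OF B[OF G]] column_finite[OF B[OF G]] by auto
    ultimately have "card {p \<in> P3. F3 p \<subseteq> G} \<le> card ?W"
      using card_mono by blast
    also have "\<dots> \<le> K * r"
      by (intro card_Sigma_le row_finite column_finite row_le column_le B G)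
    finally show "card {p \<in> P3. F3 p \<subseteq> G} \<le> K * r" .
  qed (use fin card2 in \<open>auto simp: P defs Q_def\<close>)
  have "card {G \<in> graphs S E. has_path E y x G} \<le> card (?T P1 e1 F1 \<union> ?T P2 e2 F2 \<union> ?T P3 e3 F3)"
    by (rule card_mono[OF _ sub]) (use finite_graphs in auto)
  also have "\<dots> \<le> card (?T P1 e1 F1) + card (?T P2 e2 F2) + card (?T P3 e3 F3)"
    by (intro order_trans[OF card_Un_le] add_mono order_refl)
  finally have "real (card {G \<in> graphs S E. has_path E y x G})
     \<le> real (card (?T P1 e1 F1)) + real (card (?T P2 e2 F2)) + real (card (?T P3 e3 F3))"
    by linarith
  also have "\<dots> \<le> \<rho> * real (r * K) * real (card (graphs S E)) + \<rho> * real (K * r) * real (card (graphs S E))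
     + \<rho> * real (K * r) * real (card (graphs S E))"
    by (intro add_mono T1 T2 T3)
  finally show ?thesis by (simp add: mult_ac)
qed

text \<open>The 8 adds up the losses in \<open>switch_lower\<close>: 3 for each of the two kinds of
  3-paths, and 1 for each of the two edges to be inserted, which might already be present.\<close>

definition \<theta> :: real where "\<theta> = 8 * \<rho> * real (K * r)"

lemma \<theta>_eq: "\<theta> = 16 * real (K * r)^2 / real (m * r)"
  by (simp add: \<theta>_def \<rho>_def power2_eq_square)

lemma \<theta>_nonneg: "0 \<le> \<theta>"
  by (simp add: \<theta>_eq)

lemma \<theta>_le: "\<theta> \<le> 1 / 10"
proof -
  have "real (160 * (K * r)^2) \<le> real (m * r)" using sparse by (simp only: of_nat_le_iff)
  then have "160 * real (K * r)^2 \<le> real (m * r)"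
    by (simp only: of_nat_mult of_nat_power of_nat_numeral)
  moreover have "0 < real (m * r)" using mr_pos by (simp only: of_nat_0_less_iff)
  ultimately show ?thesis by (simp only: \<theta>_eq pos_divide_le_eq)
qed

text \<open>The condition on \<open>(j', i')\<close> ensures that the second edge \<open>(y, x)\<close> inserted by the reverse
  switching is never one of the prescribed edges \<open>E\<close>.\<close>

lemma switch_lower:
  assumes e: "(j, i) \<notin> E" "j \<in> {1..n}" "i \<in> {1..m}"
    and E: "E \<subseteq> {j, j'} \<times> {i, i'}" "(j', i') \<in> E \<Longrightarrow> (j, i') \<in> E \<or> (j', i) \<in> E"
    and S: "S \<subseteq> rects" "({j, j'}, {i, i'}) \<notin> S"
  defines "D \<equiv> (k j - card {x. (j, x) \<in> E}) * (r - card {y. (y, i) \<in> E})"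
  shows "(1 - \<theta>) * real D * real (card (graphs S E)) \<le> real (m * r) * real (card (graphs S (insert (j, i) E)))"
proof -
  define A where "A = graphs S E"
  define prs where "prs = (\<lambda>G. ({x. (j, x) \<in> G} - {x. (j, x) \<in> E}) \<times> ({y. (y, i) \<in> G} - {y. (y, i) \<in> E}))"
  define Q where "Q = (SIGMA G:A. prs G)"
  define F where "F = (\<lambda>(x, y). {(j, x), (y, i)})"
  have B: "G \<in> bigraphs n r k" if "G \<in> graphs S E'" for G E' using that by (auto simp: graphs_def)
  have finE: "finite E" using E(1) finite_subset by blast
  have cardE: "card E \<le> 3"
  proof -
    have "E \<subseteq> {(j, i'), (j', i), (j', i')}" using E(1) e(1) by auto
    then have "card E \<le> card {(j, i'), (j', i), (j', i')}" by (intro card_mono) auto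
    also have "\<dots> \<le> 3" by (auto simp: card_insert_if)
    finally show ?thesis .
  qed
  have finA: "finite A" by (simp add: A_def finite_graphs)
  have finp: "finite (prs G)" if "G \<in> A" for G
    using that row_finite[OF B] column_finite[OF B] unfolding prs_def A_def by auto
  have finQ: "finite Q" unfolding Q_def using finA finp by (intro finite_SigmaI) auto
  have cardS: "card (SIGMA G:A'. prs G) = card A' * D" if "A' \<subseteq> A" for A'
    unfolding prs_def D_def using that e unfolding A_def by (intro card_Sigma_pairs) auto

  define P where "P = {(x, y). x \<in> {1..m} \<and> y \<in> {1..n} \<and> (j, x) \<notin> E \<and> (y, i) \<notin> E}"
  have finP: "finite P" unfolding P_def by (rule finite_subset[of _ "{1..m} \<times> {1..n}"]) auto
  \<comment> \<open>Pairs of a graph and a candidate for switching are counted first by the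
    candidate, then by the graph; every graph has exactly \<open>D\<close> candidates.\<close>
  have sumP: "(\<Sum>p\<in>P. card (graphs S (E \<union> F p))) = D * card A"
  proof -
    have "(\<Sum>p\<in>P. card (graphs S (E \<union> F p))) = (\<Sum>G\<in>A. card {p \<in> P. F p \<subseteq> G})"
      unfolding A_def by (rule sum_card_graphs[OF finP])
    also have "\<dots> = (\<Sum>G\<in>A. card (prs G))"
    proof (intro sum.cong refl arg_cong[where f=card])
      fix G assume "G \<in> A"
      then have "G \<subseteq> {1..n} \<times> {1..m}" using B by (auto simp: A_def bigraphs_eq)
      then show "{p \<in> P. F p \<subseteq> G} = prs G" by (auto simp: P_def F_def prs_def)
    qed
    also have "\<dots> = card Q" unfolding Q_def using finA finp by (simp add: card_SigmaI)
    also have "\<dots> = D * card A" unfolding Q_def by (simp add: cardS)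
    finally show ?thesis .
  qed
  \<comment> \<open>The graphs are grouped by the pair \<open>(x, y)\<close>, and \<open>R\<close>
    is estimated conditionally on the edges \<open>(j, x)\<close> and \<open>(y, i)\<close>. If
    every conditional probability is at most \<open>c\<close>, so is the share of all candidates
    with property \<open>R\<close>. The absence of \<open>(j, i)\<close> provides
    \<open>x \<noteq> i\<close> and \<open>y \<noteq> j\<close>.\<close>
  have bad: "real (card {(G, x, y) \<in> Q. (j, i) \<notin> G \<and> R x y G}) \<le> c * (real D * real (card A))"
    if R: "\<And>x y. x \<noteq> i \<Longrightarrow> y \<noteq> j \<Longrightarrow> (j, x) \<notin> E \<Longrightarrow> (y, i) \<notin> E \<Longrightarrow>
        real (card {G \<in> graphs S (E \<union> F (x, y)). R x y G}) \<le> c * real (card (graphs S (E \<union> F (x, y))))"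
      and c: "0 \<le> c" for R c
  proof -
    define P' where "P' = {(x, y) \<in> P. x \<noteq> i \<and> y \<noteq> j}"
    have P': "P' \<subseteq> P" "finite P'" using finP by (auto simp: P'_def intro: finite_subset)
    let ?T = "SIGMA p:P'. {G \<in> graphs S (E \<union> F p). R (fst p) (snd p) G}"
    have sub: "{(G, x, y) \<in> Q. (j, i) \<notin> G \<and> R x y G} \<subseteq> (\<lambda>(p, G). (G, fst p, snd p)) ` ?T"
    proof
      fix z assume "z \<in> {(G, x, y) \<in> Q. (j, i) \<notin> G \<and> R x y G}"
      then obtain G x y where z: "z = (G, x, y)" and G: "(G, x, y) \<in> Q" "(j, i) \<notin> G" "R x y G" by auto
      have GS: "G \<in> graphs S E" and xy: "(j, x) \<in> G" "(y, i) \<in> G" "(j, x) \<notin> E" "(y, i) \<notin> E"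
        using G(1) by (auto simp: Q_def A_def prs_def)
      have "x \<in> {1..m}" "y \<in> {1..n}" using B[OF GS] xy(1,2) unfolding bigraphs_eq by blast+
      moreover have "x \<noteq> i" "y \<noteq> j" using xy G(2) by auto
      ultimately have "(x, y) \<in> P'" using xy by (simp add: P'_def P_def)
      moreover have "G \<in> graphs S (E \<union> F (x, y))" using GS xy unfolding graphs_Un F_def by simp
      ultimately have "((x, y), G) \<in> ?T" using G(3) by simp
      then show "z \<in> (\<lambda>(p, G). (G, fst p, snd p)) ` ?T"
        using z by (intro image_eqI[of _ _ "((x, y), G)"]) auto
    qed
    have fT: "finite ?T" using P' finite_graphs by (intro finite_SigmaI) auto
    have "card {(G, x, y) \<in> Q. (j, i) \<notin> G \<and> R x y G} \<le> card ?T"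
      by (rule surj_card_le[OF fT sub])
    also have "card ?T = (\<Sum>p\<in>P'. card {G \<in> graphs S (E \<union> F p). R (fst p) (snd p) G})"
      using P' finite_graphs by (intro card_SigmaI) auto
    finally have "real (card {(G, x, y) \<in> Q. (j, i) \<notin> G \<and> R x y G})
      \<le> (\<Sum>p\<in>P'. real (card {G \<in> graphs S (E \<union> F p). R (fst p) (snd p) G}))"
      by (simp only: of_nat_le_iff flip: of_nat_sum)
    also have "\<dots> \<le> (\<Sum>p\<in>P'. c * real (card (graphs S (E \<union> F p))))"
      by (rule sum_mono) (use R in \<open>auto simp: P'_def P_def\<close>)
    also have "\<dots> \<le> (\<Sum>p\<in>P. c * real (card (graphs S (E \<union> F p))))"
      using P' finP c by (intro sum_mono2) auto
    also have "\<dots> = c * real (\<Sum>p\<in>P. card (graphs S (E \<union> F p)))" by (simp add: sum_distrib_left)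
    also have "\<dots> = c * (real D * real (card A))" by (simp add: sumP)
    finally show ?thesis .
  qed

  \<comment> \<open>In \<open>bad1\<close> and \<open>bad3\<close> one of the edges
    \<open>(j, i)\<close> and \<open>(y, x)\<close> to be inserted is already present; in
    \<open>bad2\<close> and \<open>bad4\<close> a 3-path joins the ends of one of them. The first
    two depend on the graph alone, so each graph concerned contributes exactly \<open>D\<close>
    candidates; the other two are handled by conditioning.\<close>
  define bad1 where "bad1 = (SIGMA G:graphs S (insert (j, i) E). prs G)"
  define bad2 where "bad2 = (SIGMA G:{G \<in> A. has_path E j i G}. prs G)"
  define bad3 where "bad3 = {(G, x, y) \<in> Q. (j, i) \<notin> G \<and> (y, x) \<in> G}"
  define bad4 where "bad4 = {(G, x, y) \<in> Q. (j, i) \<notin> G \<and> has_path (E \<union> F (x, y)) y x G}"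
  define good where "good = Q - bad1 - bad2 - bad3 - bad4"
  let ?V = "real (K * r)" and ?W = "real D * real (card A)"
  have sub1: "graphs S (insert (j, i) E) \<subseteq> A" by (auto simp: A_def graphs_def)
  have b1: "real (card bad1) \<le> \<rho> * ?W"
  proof -
    have "real (card bad1) = real D * real (card (graphs S (insert (j, i) E)))"
      unfolding bad1_def using cardS[OF sub1] by simp
    also have "\<dots> \<le> real D * (\<rho> * real (card A))"
      unfolding A_def using cardE finE by (intro mult_left_mono edge_upper e S) auto
    finally show ?thesis by (simp add: mult_ac)
  qed
  have b2: "real (card bad2) \<le> 3 * \<rho> * ?V * ?W"
  proof -
    have "{G \<in> A. has_path E j i G} \<subseteq> A" by auto
    then have "real (card bad2) = real D * real (card {G \<in> A. has_path E j i G})"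
      unfolding bad2_def by (simp add: cardS)
    also have "\<dots> \<le> real D * (3 * \<rho> * ?V * real (card A))"
      unfolding A_def using cardE finE by (intro mult_left_mono path_bound S) auto
    finally show ?thesis by (simp add: mult_ac)
  qed
  have b3: "real (card bad3) \<le> \<rho> * ?W"
    unfolding bad3_def
  proof (rule bad)
    fix x y assume xy: "x \<noteq> i" "y \<noteq> j" "(j, x) \<notin> E" "(y, i) \<notin> E"
    have "(y, x) \<notin> E" using xy E by auto
    then have ne: "(y, x) \<notin> E \<union> F (x, y)" using xy by (auto simp: F_def)
    have "{G \<in> graphs S (E \<union> F (x, y)). (y, x) \<in> G} = graphs S (insert (y, x) (E \<union> F (x, y)))"
      by (auto simp: graphs_def)
    moreover have "card (E \<union> F (x, y)) \<le> 9"
      using card_Un_le[of E "F (x, y)"] cardE card_insert_le_m1[of 2 "{(y,i)}" "(j,x)"] by (simp add: F_def)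
    ultimately show "real (card {G \<in> graphs S (E \<union> F (x, y)). (y, x) \<in> G})
        \<le> \<rho> * real (card (graphs S (E \<union> F (x, y))))"
      using edge_upper[OF ne _ _ S(1)] finE by (simp add: F_def)
  qed (rule \<rho>_nonneg)
  have b4: "real (card bad4) \<le> 3 * \<rho> * ?V * ?W"
    unfolding bad4_def
  proof (rule bad)
    fix x y assume xy: "x \<noteq> i" "y \<noteq> j" "(j, x) \<notin> E" "(y, i) \<notin> E"
    have "card (E \<union> F (x, y)) \<le> 5"
      using card_Un_le[of E "F (x, y)"] cardE card_insert_le_m1[of 2 "{(y,i)}" "(j,x)"] by (simp add: F_def)
    then show "real (card {G \<in> graphs S (E \<union> F (x, y)). has_path (E \<union> F (x, y)) y x G})
        \<le> 3 * \<rho> * ?V * real (card (graphs S (E \<union> F (x, y))))"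
      using finE by (intro path_bound S) (auto simp: F_def)
  qed (use \<rho>_nonneg in simp)
  have finbad: "finite bad1" "finite bad2" "finite bad3" "finite bad4" "finite good"
  proof -
    have "bad1 \<subseteq> Q" using sub1 unfolding bad1_def Q_def by blast
    moreover have "bad2 \<subseteq> Q" unfolding bad2_def Q_def by blast
    moreover have "bad3 \<subseteq> Q" unfolding bad3_def by blast
    moreover have "bad4 \<subseteq> Q" unfolding bad4_def by blast
    moreover have "good \<subseteq> Q" unfolding good_def by blast
    ultimately show "finite bad1" "finite bad2" "finite bad3" "finite bad4" "finite good"
      using finQ finite_subset by blast+
  qed
  have cQ: "card A * D \<le> card good + card bad1 + card bad2 + card bad3 + card bad4"
  proof -
    have "card A * D = card Q" unfolding Q_def by (simp add: cardS)
    also have "\<dots> \<le> card (good \<union> bad1 \<union> bad2 \<union> bad3 \<union> bad4)"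
      by (rule card_mono) (use finbad in \<open>auto simp: good_def\<close>)
    also have "\<dots> \<le> card good + card bad1 + card bad2 + card bad3 + card bad4"
      by (intro order_trans[OF card_Un_le] add_mono order_refl)
    finally show ?thesis .
  qed
  \<comment> \<open>A good switching is determined by the resulting graph and its edge
    \<open>(y, x)\<close>, for which there are \<open>m r\<close> possibilities.\<close>
  have cg: "card good \<le> card (graphs S (insert (j, i) E)) * (m * r)"
  proof -
    let ?H = "SIGMA H:graphs S (insert (j, i) E). H"
    let ?f = "\<lambda>(G, x, y). (switch G j x y i, y, x)"
    have g: "G \<in> bigraphs n r k" "E \<subseteq> G" "(j, x) \<in> G" "(y, i) \<in> G" "(j, i) \<notin> G" "(y, x) \<notin> G"
        "(j, x) \<notin> E" "(y, i) \<notin> E"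
        "\<not> has_path E j i G" "\<not> has_path (E \<union> F (x, y)) y x G"
        "\<And>X Y. (X, Y) \<in> S \<Longrightarrow> \<not> X \<times> Y \<subseteq> G" if "(G, x, y) \<in> good" for G x y
      using that unfolding good_def bad1_def bad2_def bad3_def bad4_def Q_def prs_def A_def graphs_def by auto
    have "card good \<le> card ?H"
    proof (rule card_inj_on_le)
      show "inj_on ?f good"
      proof (rule inj_onI)
        fix p q assume pq: "p \<in> good" "q \<in> good" "?f p = ?f q"
        obtain G x y where p: "p = (G, x, y)" by (cases p)
        obtain G' where q: "q = (G', x, y)" using pq(3) p by (cases q) auto
        have "switch G j x y i = switch G' j x y i" using pq(3) p q by simp
        then have "switch (switch G j x y i) j i y x = switch (switch G' j x y i) j i y x" by simp
        then show "p = q" using switch_switch[OF g(3-6)] pq p q by metis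
      qed
      show "?f ` good \<subseteq> ?H"
      proof
        fix q assume "q \<in> ?f ` good"
        then obtain G x y where q: "q = (switch G j x y i, y, x)" and p: "(G, x, y) \<in> good" by auto
        note g = g[OF p]
        have "\<not> X \<times> Y \<subseteq> switch G j x y i" if XY: "(X, Y) \<in> S" for X Y
        proof
          assume "X \<times> Y \<subseteq> switch G j x y i"
          moreover have "card X = 2" "card Y = 2" using XY S by (auto simp: rects_def)
          ultimately consider a b where "path3 (G - {(j, x), (y, i)}) j i a b" "X = {j, b}" "Y = {a, i}"
            | a b where "path3 (G - {(j, x), (y, i)}) y x a b"
            using switch_new_rectangle[OF _ g(11)[OF XY] _ _ g(3-6)] by blast
          then show False
          proof cases
            case (1 a b)
            \<comment> \<open>A path inside \<open>E\<close> can only be \<open>j\<close>,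
              \<open>i'\<close>, \<open>j'\<close>, \<open>i\<close>. The rectangle it completes is
              the very one whose probability is being estimated, and that one is not in
              \<open>S\<close>.\<close>
            have "b \<noteq> j" "a \<noteq> i" "path3 G j i a b" using 1 by (auto simp: path3_def)
            moreover from this have "{(j, a), (b, a), (b, i)} \<subseteq> E"
              using g(9) by (auto simp: has_path_def)
            ultimately have "b = j'" "a = i'" using E(1) by auto
            then show False using 1 XY S(2) by (simp add: insert_commute)
          next
            case (2 a b)
            \<comment> \<open>The path avoids the removed edges \<open>F (x, y)\<close>, so it would
              have to lie in \<open>E\<close>. Its last edge would then be \<open>(j, x)\<close>,
              which was chosen outside \<open>E\<close>.\<close>
            have ne: "b \<noteq> y" "path3 G y x a b" "{(y, a), (b, a), (b, x)} \<inter> F (x, y) = {}"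
              using 2 by (auto simp: path3_def F_def)
            then have "{(y, a), (b, a), (b, x)} \<subseteq> E"
              using g(10) unfolding has_path_def by blast
            moreover have "y \<noteq> j" "x \<noteq> i" using g by auto
            ultimately have "b = j" "(b, x) \<in> E" using E(1) ne(1) by auto
            then show False using g by simp
          qed
        qed
        moreover have "insert (j, i) E \<subseteq> switch G j x y i" using g by (auto simp: switch_def)
        ultimately have "switch G j x y i \<in> graphs S (insert (j, i) E)"
          using switch_bigraph[OF g(1,3-6)] by (auto simp: graphs_def)
        moreover have "(y, x) \<in> switch G j x y i" by (auto simp: switch_def)
        ultimately show "q \<in> ?H" by (simp add: q)
      qed
      show "finite ?H" using finite_graphs graph_finite[OF B] by (intro finite_SigmaI) auto
    qed
    also have "card ?H = (\<Sum>H\<in>graphs S (insert (j, i) E). card H)"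
      using finite_graphs graph_finite[OF B] by (intro card_SigmaI) auto
    also have "\<dots> = card (graphs S (insert (j, i) E)) * (m * r)"
      using graph_card[OF B] by simp
    finally show ?thesis .
  qed
  have V1: "2 * (\<rho> * ?W) \<le> 2 * \<rho> * ?V * ?W"
  proof -
    have "real 1 \<le> ?V" using Kr_ge by (subst of_nat_le_iff) linarith
    then have "1 \<le> ?V" by (simp only: of_nat_1)
    then have "\<rho> * ?W * 1 \<le> \<rho> * ?W * ?V"
      using \<rho>_nonneg by (intro mult_left_mono) auto
    then show ?thesis by (simp add: mult_ac)
  qed
  have "real (card A * D) \<le> real (card good + card bad1 + card bad2 + card bad3 + card bad4)"
    using cQ by (simp only: of_nat_le_iff)
  then have "?W \<le> real (card good) + real (card bad1) + real (card bad2) + real (card bad3) + real (card bad4)"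
    by (simp add: mult.commute)
  also have "\<dots> \<le> real (card good) + \<rho> * ?W + 3 * \<rho> * ?V * ?W + \<rho> * ?W + 3 * \<rho> * ?V * ?W"
    by (intro add_mono b1 b2 b3 b4 order_refl)
  also have "\<dots> \<le> real (card good) + \<theta> * ?W"
    using V1 by (simp add: \<theta>_def algebra_simps)
  also have "\<dots> \<le> real (card (graphs S (insert (j, i) E)) * (m * r)) + \<theta> * ?W"
    using cg by (simp only: of_nat_le_iff add_le_cancel_right)
  finally show ?thesis by (simp add: A_def algebra_simps)
qed

text \<open>The counterpart of \<open>switch_lower\<close>. With \<open>v = (K r)^2\<close> and
  \<open>M = m r\<close> one has \<open>\<theta> M = 16 v\<close>, so the factor
  \<open>1 + \<theta>\<close> compensates for the \<open>5 v\<close> lost switchings: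
  \<open>(1 + \<theta>) (M - 5 v) = M + 11 v - 5 \<theta> v \<ge> M\<close>.\<close>

lemma switch_upper_real:
  assumes e: "(j, i) \<notin> E" "j \<in> {1..n}" "i \<in> {1..m}" and E: "card E \<le> 9" "finite E"
    and S: "S \<subseteq> rects"
  defines "D \<equiv> (k j - card {x. (j, x) \<in> E}) * (r - card {y. (y, i) \<in> E})"
  shows "real (m * r) * real (card (graphs S (insert (j, i) E))) \<le> (1 + \<theta>) * real D * real (card (graphs S E))"
proof -
  let ?N = "real (card (graphs S E))" and ?N' = "real (card (graphs S (insert (j, i) E)))"
  define M v where "M = real (m * r)" and "v = real ((K * r)^2)"
  have M: "0 < M" unfolding M_def using mr_pos by (simp only: of_nat_0_less_iff)
  have v: "0 \<le> v" unfolding v_def by (rule of_nat_0_le_iff)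
  have "\<theta> = 16 * v / M" by (simp only: \<theta>_eq v_def M_def of_nat_power)
  then have th: "\<theta> * M = 16 * v" using M by simp
  have "real (m * r - 5 * (K * r)^2) = M - 5 * v"
    unfolding M_def v_def using sparse by (subst of_nat_diff) auto
  moreover have "real (card (graphs S (insert (j, i) E)) * (m * r - 5 * (K * r)^2)) \<le> real (card (graphs S E) * D)"
    unfolding D_def using switch_upper[OF e E S] by (simp only: of_nat_le_iff)
  ultimately have main: "?N' * (M - 5 * v) \<le> ?N * real D" by (simp only: of_nat_mult)
  have "M \<le> (1 + \<theta>) * (M - 5 * v)"
  proof -
    have "\<theta> * v \<le> 1 / 10 * v" by (intro mult_right_mono \<theta>_le v)
    moreover have "(1 + \<theta>) * (M - 5 * v) = M + 11 * v - 5 * (\<theta> * v)"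
      using th by (simp add: algebra_simps)
    ultimately show ?thesis using v by linarith
  qed
  then have "M * ?N' \<le> (1 + \<theta>) * (M - 5 * v) * ?N'"
    by (intro mult_right_mono) auto
  also have "\<dots> = (1 + \<theta>) * (?N' * (M - 5 * v))" by (simp add: mult_ac)
  also have "\<dots> \<le> (1 + \<theta>) * (?N * real D)"
    using \<theta>_nonneg by (intro mult_left_mono main) auto
  finally show ?thesis by (simp add: M_def mult_ac)
qed

text \<open>The approximate probability of a 4-cycle with left part \<open>X\<close>, as a product
  of four edge probabilities. It is independent of the right part because all right vertices have
  degree \<open>r\<close>.\<close>

definition weight :: "nat set \<Rightarrow> real" where
  "weight X = (\<Prod>a\<in>X. real (k a * (k a - 1))) * real ((r * (r - 1))^2) / real (m * r)^4"

text \<open>The edges are revealed in the order \<open>(a, c)\<close>, \<open>(a, d)\<close>,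
  \<open>(b, c)\<close>, \<open>(b, d)\<close>. The remaining degrees contribute
  \<open>k_a r\<close>, \<open>(k_a - 1) r\<close>, \<open>k_b (r - 1)\<close> and
  \<open>(k_b - 1) (r - 1)\<close>. Four relative errors \<open>\<theta>\<close> combine to
  \<open>(1 \<plusminus> \<theta>)^4\<close>, which stays within
  \<open>1 \<plusminus> 5 \<theta>\<close> as \<open>\<theta> \<le> 1 / 10\<close>.\<close>

lemma rectangle_count:
  assumes S: "S \<subseteq> rects" and C: "(X, Y) \<in> rects" "(X, Y) \<notin> S"
  shows "\<bar>real (card (graphs S (X \<times> Y))) - weight X * real (card (graphs S {}))\<bar>
     \<le> 5 * \<theta> * weight X * real (card (graphs S {}))"
proof -
  obtain a b where X: "X = {a, b}" "a \<noteq> b" using C(1) by (auto simp: rects_def card_2_iff)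
  obtain c d where Y: "Y = {c, d}" "c \<noteq> d" using C(1) by (auto simp: rects_def card_2_iff)
  have rng: "a \<in> {1..n}" "b \<in> {1..n}" "c \<in> {1..m}" "d \<in> {1..m}"
    using C(1) X Y by (auto simp: rects_def)
  have nS: "({a, b}, {c, d}) \<notin> S" "({a, b}, {d, c}) \<notin> S" "({b, a}, {c, d}) \<notin> S" "({b, a}, {d, c}) \<notin> S"
    using C(2) X Y by (simp_all add: insert_commute)
  let ?g = "\<lambda>E. real (card (graphs S E))"
  define E1 E2 E3 E4 where E: "E1 = {(a, c)}" "E2 = {(a, d), (a, c)}" "E3 = {(b, c), (a, d), (a, c)}"
    "E4 = {(b, d), (b, c), (a, d), (a, c)}"
  let ?M = "real (m * r)"
  have c3: "card {u, v, w} \<le> 9" for u v w :: "nat \<times> nat" by (simp add: card_insert_if)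
  have 1: "(1 - \<theta>) * real (k a * r) * ?g {} \<le> ?M * ?g E1"
      "?M * ?g E1 \<le> (1 + \<theta>) * real (k a * r) * ?g {}"
    using switch_lower[of a c "{}" b d S] switch_upper_real[of a c "{}" S] rng S nS by (simp_all add: E)
  have d2: "card {x. (a, x) \<in> E1} = 1" "card {y. (y, d) \<in> E1} = 0"
    using Y by (auto simp: E)
  have 2: "(1 - \<theta>) * real ((k a - 1) * r) * ?g E1 \<le> ?M * ?g E2"
      "?M * ?g E2 \<le> (1 + \<theta>) * real ((k a - 1) * r) * ?g E1"
    using switch_lower[of a d E1 b c S] switch_upper_real[of a d E1 S] rng S nS d2 X Y
    by (simp_all add: E)
  have "{x. (b, x) \<in> E2} = {}" "{y. (y, c) \<in> E2} = {a}" using X Y by (auto simp: E)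
  then have d3: "card {x. (b, x) \<in> E2} = 0" "card {y. (y, c) \<in> E2} = 1" by simp_all
  have 3: "(1 - \<theta>) * real (k b * (r - 1)) * ?g E2 \<le> ?M * ?g E3"
      "?M * ?g E3 \<le> (1 + \<theta>) * real (k b * (r - 1)) * ?g E2"
    using switch_lower[of b c E2 a d S] switch_upper_real[of b c E2 S] rng S nS d3 X Y
    by (simp_all add: E)
  have "{x. (b, x) \<in> E3} = {c}" "{y. (y, d) \<in> E3} = {a}" using X Y by (auto simp: E)
  then have d4: "card {x. (b, x) \<in> E3} = 1" "card {y. (y, d) \<in> E3} = 1" by simp_all
  have 4: "(1 - \<theta>) * real ((k b - 1) * (r - 1)) * ?g E3 \<le> ?M * ?g E4"
      "?M * ?g E4 \<le> (1 + \<theta>) * real ((k b - 1) * (r - 1)) * ?g E3"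
    using switch_lower[of b d E3 a c S] switch_upper_real[of b d E3 S] rng S nS d4 X Y c3
    by (simp_all add: E)
  have t: "0 \<le> \<theta>" "\<theta> \<le> 1" using \<theta>_nonneg \<theta>_le by auto
  note c2 = chain_bounds[OF 1 2 t]
  have c2: "((1 - \<theta>) * real (k a * r) * ((1 - \<theta>) * real ((k a - 1) * r))) * ?g {} \<le> (?M * ?M) * ?g E2"
     "(?M * ?M) * ?g E2 \<le> ((1 + \<theta>) * real (k a * r) * ((1 + \<theta>) * real ((k a - 1) * r))) * ?g {}"
    by (rule c2; simp)+
  note c3 = chain_bounds[OF c2 3 t]
  have c3: "((1 - \<theta>) * real (k a * r) * ((1 - \<theta>) * real ((k a - 1) * r)) * ((1 - \<theta>) * real (k b * (r - 1)))) * ?g {} \<le> (?M * ?M * ?M) * ?g E3"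
     "(?M * ?M * ?M) * ?g E3 \<le> ((1 + \<theta>) * real (k a * r) * ((1 + \<theta>) * real ((k a - 1) * r)) * ((1 + \<theta>) * real (k b * (r - 1)))) * ?g {}"
    by (rule c3; simp)+
  note c4 = chain_bounds[OF c3 4 t]
  have c4: "((1 - \<theta>) * real (k a * r) * ((1 - \<theta>) * real ((k a - 1) * r)) * ((1 - \<theta>) * real (k b * (r - 1))) * ((1 - \<theta>) * real ((k b - 1) * (r - 1)))) * ?g {} \<le> (?M * ?M * ?M * ?M) * ?g E4"
     "(?M * ?M * ?M * ?M) * ?g E4 \<le> ((1 + \<theta>) * real (k a * r) * ((1 + \<theta>) * real ((k a - 1) * r)) * ((1 + \<theta>) * real (k b * (r - 1))) * ((1 + \<theta>) * real ((k b - 1) * (r - 1)))) * ?g {}"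
    by (rule c4; simp)+
  define w where "w = real (k a * r) * real ((k a - 1) * r) * real (k b * (r - 1)) * real ((k b - 1) * (r - 1))"
  have w0: "0 \<le> w * ?g {}" unfolding w_def by simp
  have wX: "weight X * ?M^4 = w"
    using X(2) mr_pos by (simp add: weight_def X(1) w_def power2_eq_square)
  have E4: "X \<times> Y = E4" by (auto simp: X Y E)
  have M4: "0 < ?M^4" using mr_pos by simp
  have lo: "(1 - \<theta>)^4 * (w * ?g {}) \<le> ?M^4 * ?g E4" and hi: "?M^4 * ?g E4 \<le> (1 + \<theta>)^4 * (w * ?g {})"
    using c4 by (simp_all only: w_def power4_eq_xxxx mult_ac)
  have lo': "1 - 5 * \<theta> \<le> (1 - \<theta>)^4"
    using Bernoulli_inequality[of "- \<theta>" 4] t by simp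
  have hi': "(1 + \<theta>)^4 \<le> 1 + 5 * \<theta>"
  proof -
    have "(1 + \<theta>)^4 = 1 + 4 * \<theta> + \<theta> * (6 * \<theta> + 4 * \<theta>^2 + \<theta>^3)"
      by (simp add: power4_eq_xxxx power2_eq_square power3_eq_cube algebra_simps)
    also have "\<dots> \<le> 1 + 4 * \<theta> + \<theta> * (6 * (1 / 10) + 4 * (1 / 10)^2 + (1 / 10)^3)"
      using t \<theta>_le by (intro add_mono mult_left_mono power_mono) auto
    also have "\<dots> \<le> 1 + 5 * \<theta>" using t by (simp add: power2_eq_square power3_eq_cube)
    finally show ?thesis .
  qed
  have "(1 - 5 * \<theta>) * (w * ?g {}) \<le> ?M^4 * ?g E4" "?M^4 * ?g E4 \<le> (1 + 5 * \<theta>) * (w * ?g {})"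
    using mult_right_mono[OF lo' w0] mult_right_mono[OF hi' w0] lo hi by linarith+
  then have "\<bar>?M^4 * ?g E4 - w * ?g {}\<bar> \<le> 5 * \<theta> * (w * ?g {})"
    by (simp add: abs_le_iff algebra_simps)
  moreover have "?M^4 * ?g E4 - w * ?g {} = ?M^4 * (?g E4 - weight X * ?g {})"
    unfolding wX[symmetric] by (simp only: right_diff_distrib mult_ac)
  ultimately have "?M^4 * \<bar>?g E4 - weight X * ?g {}\<bar> \<le> 5 * \<theta> * (w * ?g {})"
    using M4 by (simp only: abs_mult abs_of_pos)
  also have "\<dots> = ?M^4 * (5 * \<theta> * weight X * ?g {})"
    unfolding wX[symmetric] by (simp only: mult_ac)
  finally have "?M^4 * \<bar>?g E4 - weight X * ?g {}\<bar> \<le> ?M^4 * (5 * \<theta> * weight X * ?g {})" .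
  then show ?thesis using M4 unfolding E4 by (simp only: mult_le_cancel_left_pos)
qed

end

section \<open>Existence of a graph\<close>

context degree_sequence
begin

text \<open>Cut \<open>{..<m r}\<close> into consecutive blocks of lengths \<open>k\<^sub>1, \<dots>, k\<^sub>n\<close> and join the owner of the
  point \<open>p\<close> to the right vertex \<open>p mod m\<close> (shifted by one).\<close>

lemma bigraphs_nonempty:
  assumes Km: "K \<le> m"
  shows "bigraphs n r k \<noteq> {}"
proof -
  define s where "s = (\<lambda>j. \<Sum>l\<in>{1..<j}. k l)"
  define Sg where "Sg = (SIGMA j:{1..n}. {s j..<s j + k j})"
  define B where "B = (\<lambda>(j, p). (j, p mod m + 1)) ` Sg"
  have m: "0 < m" using Km K_ge by simp
  have s_Suc: "s (Suc j) = s j + k j" if "1 \<le> j" for j using that by (simp add: s_def)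
  have s_mono: "s i \<le> s j" if "i \<le> j" for i j
    unfolding s_def using that by (intro sum_mono2) auto
  have s_le: "s j + k j \<le> s j'" if "1 \<le> j" "j < j'" for j j'
    using s_mono[of "Suc j" j'] s_Suc that by simp
  have s_end: "s (Suc n) = m * r"
    using sum_k by (simp add: s_def atLeastLessThanSuc_atLeastAtMost)
  have finSg: "finite Sg" unfolding Sg_def by auto
  have inj: "inj_on snd Sg"
  proof (rule inj_onI)
    fix z w assume "z \<in> Sg" "w \<in> Sg" "snd z = snd w"
    then obtain j j' p where z: "z = (j, p)" "w = (j', p)" "1 \<le> j" "1 \<le> j'"
      "s j \<le> p" "p < s j + k j" "s j' \<le> p" "p < s j' + k j'"
      by (cases z, cases w) (auto simp: Sg_def)
    have "\<not> j < j'" "\<not> j' < j" using s_le[of j j'] s_le[of j' j] z by auto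
    then show "z = w" using z by simp
  qed
  have sub: "snd ` Sg \<subseteq> {..<m * r}"
  proof
    fix p assume "p \<in> snd ` Sg"
    then obtain j where "1 \<le> j" "j \<le> n" "p < s j + k j" by (auto simp: Sg_def)
    then have "p < s (Suc n)" using s_le[of j "Suc n"] by simp
    then show "p \<in> {..<m * r}" by (simp add: s_end)
  qed
  have "card (snd ` Sg) = m * r"
  proof -
    have "card (snd ` Sg) = card Sg" by (rule card_image[OF inj])
    also have "\<dots> = (\<Sum>j=1..n. k j)" unfolding Sg_def by (subst card_SigmaI) auto
    also have "\<dots> = m * r" by (rule sum_k)
    finally show ?thesis .
  qed
  then have surj: "snd ` Sg = {..<m * r}" by (intro card_subset_eq sub) auto
  \<comment> \<open>A block has at most \<open>K \<le> m\<close> points, so no two of them are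
    congruent modulo \<open>m\<close>. Hence no edge arises twice, and the degrees are not
    diminished.\<close>
  have close: "p = q" if "s j \<le> p" "p < s j + k j" "s j \<le> q" "q < s j + k j" "j \<in> {1..n}"
    "p mod m = q mod m" for j p q
  proof -
    have lt: "\<bar>int p - int q\<bar> < int m" using that(1-4) k_le[OF that(5)] Km by linarith
    have "int m dvd int p - int q" using that(6) by (metis mod_eq_dvd_iff of_nat_mod)
    then have "int p - int q = 0" using lt by (metis dvd_imp_le_int abs_of_nat not_le)
    then show ?thesis by simp
  qed
  have "B \<subseteq> {1..n} \<times> {1..m}"
  proof
    fix z assume "z \<in> B"
    then obtain j p where "z = (j, p mod m + 1)" "j \<in> {1..n}" by (auto simp: B_def Sg_def)
    moreover have "p mod m < m" using m by simp
    ultimately show "z \<in> {1..n} \<times> {1..m}" by simp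
  qed
  moreover have "card {i. (j, i) \<in> B} = k j" if j: "j \<in> {1..n}" for j
  proof -
    have "{i. (j, i) \<in> B} = (\<lambda>p. p mod m + 1) ` {s j..<s j + k j}"
      using j by (force simp: B_def Sg_def)
    moreover have "inj_on (\<lambda>p. p mod m + 1) {s j..<s j + k j}"
      by (rule inj_onI) (use close[of j] j in auto)
    ultimately show ?thesis by (simp add: card_image)
  qed
  moreover have "card {j. (j, i) \<in> B} = r" if i: "i \<in> {1..m}" for i
  proof -
    define T where "T = {z \<in> Sg. snd z mod m = i - 1}"
    have "{j. (j, i) \<in> B} = fst ` T"
      using i by (force simp: B_def T_def)
    moreover have "inj_on fst T"
    proof (rule inj_onI)
      fix z w assume "z \<in> T" "w \<in> T" "fst z = fst w"
      then obtain j p q where "z = (j, p)" "w = (j, q)" "(j, p) \<in> Sg" "(j, q) \<in> Sg" "p mod m = q mod m"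
        by (cases z, cases w) (auto simp: T_def)
      then show "z = w" using close[of j p q] by (auto simp: Sg_def)
    qed
    moreover have "card T = card (snd ` T)"
      by (rule card_image[symmetric]) (use inj in \<open>auto simp: T_def inj_on_def\<close>)
    moreover have "snd ` T = {p \<in> {..<m * r}. p mod m = i - 1}"
      unfolding surj[symmetric] T_def by auto
    \<comment> \<open>Each residue class modulo \<open>m\<close> has exactly \<open>r\<close>
      members below \<open>m r\<close>; the \<open>- 1\<close> undoes the shift of the right
      vertices.\<close>
    moreover have "{p \<in> {..<m * r}. p mod m = i - 1} = (\<lambda>t. i - 1 + m * t) ` {..<r}"
    proof (intro equalityI subsetI)
      fix p assume p: "p \<in> {p \<in> {..<m * r}. p mod m = i - 1}"
      have pm: "i - 1 = p mod m" using p by simp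
      have "p = i - 1 + m * (p div m)" unfolding pm by simp
      moreover have "p div m < r" using p m by (simp add: less_mult_imp_div_less mult.commute)
      ultimately show "p \<in> (\<lambda>t. i - 1 + m * t) ` {..<r}" by blast
    next
      fix p assume "p \<in> (\<lambda>t. i - 1 + m * t) ` {..<r}"
      then obtain t where t: "p = i - 1 + m * t" "t < r" by auto
      have im: "i - 1 < m" using i by auto
      have "m * Suc t \<le> m * r" using t(2) by (intro mult_left_mono) auto
      then have "p < m * r" using t im by simp
      moreover have "p mod m = i - 1" using t im by simp
      ultimately show "p \<in> {p \<in> {..<m * r}. p mod m = i - 1}" by simp
    qed
    moreover have "card ((\<lambda>t. i - 1 + m * t) ` {..<r}) = r"
      using m by (subst card_image) (auto simp: inj_on_def)
    ultimately show ?thesis by (simp add: card_image)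
  qed
  ultimately have "B \<in> bigraphs n r k" by (simp add: bigraphs_eq)
  then show ?thesis by auto
qed

section \<open>The probability of having no 4-cycle\<close>

lemma graphs_empty: "graphs {} {} = bigraphs n r k"
  by (simp add: graphs_def)

text \<open>Both parts of a 4-cycle are nonempty, so its edges force them into the vertex ranges.
  Excluding all of \<open>rects\<close> therefore excludes every 4-cycle, which is the end point of
  the product.\<close>

lemma graphs_rects: "graphs rects {} = {B \<in> bigraphs n r k. four_cycles B = {}}"
proof -
  have "four_cycles B = {(X, Y) \<in> rects. X \<times> Y \<subseteq> B}" if B: "B \<in> bigraphs n r k" for B
  proof (intro equalityI subrelI)
    fix X Y assume XY: "(X, Y) \<in> four_cycles B"
    then have "X \<noteq> {}" "Y \<noteq> {}" by (auto simp: copies_def)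
    moreover have "B \<subseteq> {1..n} \<times> {1..m}" using B by (simp add: bigraphs_eq)
    then have "X \<times> Y \<subseteq> {1..n} \<times> {1..m}" using XY unfolding copies_def by blast
    ultimately have "X \<subseteq> {1..n}" "Y \<subseteq> {1..m}" by blast+
    then show "(X, Y) \<in> {(X, Y) \<in> rects. X \<times> Y \<subseteq> B}"
      using XY by (simp add: rects_def copies_def)
  next
    fix X Y assume "(X, Y) \<in> {(X, Y) \<in> rects. X \<times> Y \<subseteq> B}"
    then show "(X, Y) \<in> four_cycles B" by (simp add: rects_def copies_def)
  qed
  then have eq: "four_cycles B = {} \<longleftrightarrow> (\<forall>(X, Y)\<in>rects. \<not> X \<times> Y \<subseteq> B)" if "B \<in> bigraphs n r k" for B
    using that by auto
  show ?thesis
    unfolding graphs_def by (rule Collect_cong, rule conj_cong[OF refl]) (simp only: eq empty_subsetI simp_thms)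
qed

end

context sparse_degree_sequence
begin

lemma weight_nonneg: "0 \<le> weight X"
  unfolding weight_def by (intro divide_nonneg_nonneg mult_nonneg_nonneg prod_nonneg) auto

text \<open>Supplies the condition \<open>q \<le> t / 16\<close> of
  \<open>abs_ln_minus_ln_le\<close>. With \<open>V = K r\<close>, the weight is at most
  \<open>V^4 / M^4\<close>, and \<open>V^2 \<le> M \<le> M^3\<close> bounds this by
  \<open>V^2 / M = \<theta> / 16\<close>.\<close>

lemma weight_le:
  assumes "X \<subseteq> {1..n}" "card X = 2"
  shows "weight X \<le> \<theta> / 16"
proof -
  obtain a b where X: "X = {a, b}" "a \<noteq> b" using assms(2) by (auto simp: card_2_iff)
  define V M where "V = real (K * r)" and "M = real (m * r)"
  have f: "k a * (k a - 1) \<le> K * K" "k b * (k b - 1) \<le> K * K"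
    using k_le[of a] k_le[of b] assms(1) X by (auto intro!: mult_mono)
  have "(k a * (k a - 1)) * (k b * (k b - 1)) * (r * (r - 1))^2 \<le> (K * K) * (K * K) * (r * r)^2"
    by (intro mult_le_mono[OF mult_le_mono[OF f]] power_mono mult_le_mono) auto
  also have "\<dots> = (K * r)^4" by (simp add: power4_eq_xxxx power2_eq_square mult_ac)
  finally have "real ((k a * (k a - 1)) * (k b * (k b - 1)) * (r * (r - 1))^2) \<le> real ((K * r)^4)"
    by (simp only: of_nat_le_iff)
  then have num: "(\<Prod>a\<in>X. real (k a * (k a - 1))) * real ((r * (r - 1))^2) \<le> V^4"
    unfolding V_def using X by (simp only: X(1) of_nat_mult of_nat_power prod.insert prod.empty finite.intros) (simp add: X(2))
  have "real 1 \<le> real (m * r)" using mr_pos by (subst of_nat_le_iff) linarith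
  then have M1: "1 \<le> M" by (simp only: M_def of_nat_1)
  have "real ((K * r)^2) \<le> real (m * r)" using sparse by (subst of_nat_le_iff) linarith
  then have "V^2 \<le> M" by (simp only: V_def M_def of_nat_power)
  also have "\<dots> \<le> M^3" using power_increasing[of 1 3 M] M1 by simp
  finally have "V^2 * V^2 \<le> V^2 * M^3" by (intro mult_left_mono) auto
  then have "V^4 * M \<le> V^2 * M^4"
    using mult_right_mono[of "V^2 * V^2" "V^2 * M^3" M] M1
    by (simp only: power2_eq_square power3_eq_cube power4_eq_xxxx mult_ac)
  then have "V^4 / M^4 \<le> V^2 / M"
    using M1 by (simp add: pos_divide_le_eq pos_le_divide_eq)
  moreover have "weight X \<le> V^4 / M^4"
    unfolding weight_def using num by (simp only: flip: M_def) (intro divide_right_mono, auto)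
  ultimately show ?thesis by (simp add: \<theta>_eq V_def M_def)
qed

text \<open>The product over potential 4-cycles, as an induction. Inserting a 4-cycle into
  \<open>S\<close> removes exactly those graphs of \<open>graphs S {}\<close> that contain it, and
  \<open>rectangle_count\<close> gives their share. The error of each step is proportional to its
  weight, so the errors add up; positivity is carried along to keep the logarithms
  meaningful.\<close>

lemma log_count:
  assumes "finite S" "S \<subseteq> rects" and ne: "bigraphs n r k \<noteq> {}"
  shows "0 < card (graphs S {}) \<and>
    \<bar>ln (real (card (graphs S {}))) - ln (real (card (bigraphs n r k))) + (\<Sum>(X, Y)\<in>S. weight X)\<bar>
      \<le> 6 * \<theta> * (\<Sum>(X, Y)\<in>S. weight X)"
  using assms(1,2)
proof (induction S rule: finite_induct)
  case empty
  then show ?case using ne finite_bigraphs by (simp add: graphs_empty card_gt_0_iff)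
next
  case (insert C S)
  obtain X Y where C: "C = (X, Y)" by (cases C)
  have S: "S \<subseteq> rects" "(X, Y) \<in> rects" "(X, Y) \<notin> S" using insert C by auto
  let ?Z = "real (card (graphs S {}))" and ?N = "real (card (graphs S (X \<times> Y)))"
  have IH: "0 < ?Z" "\<bar>ln ?Z - ln (real (card (bigraphs n r k))) + (\<Sum>(X, Y)\<in>S. weight X)\<bar>
      \<le> 6 * \<theta> * (\<Sum>(X, Y)\<in>S. weight X)"
    using insert.IH[OF S(1)] by simp_all
  have "graphs (insert C S) {} = graphs S {} - graphs S (X \<times> Y)" "graphs S (X \<times> Y) \<subseteq> graphs S {}"
    by (auto simp: graphs_def C)
  then have eq: "real (card (graphs (insert C S) {})) = ?Z - ?N"
    using finite_graphs by (simp add: card_Diff_subset of_nat_diff card_mono)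
  have "weight X \<le> \<theta> / 16" using S(2) by (intro weight_le) (auto simp: rects_def)
  note step = abs_ln_minus_ln_le[OF IH(1) rectangle_count[OF S] \<theta>_le weight_nonneg this]
  have sum: "(\<Sum>(X, Y)\<in>insert C S. weight X) = weight X + (\<Sum>(X, Y)\<in>S. weight X)"
    using insert.hyps C by simp
  have "0 < card (graphs (insert C S) {})" using step(1) eq by linarith
  moreover have "\<bar>ln (?Z - ?N) - ln (real (card (bigraphs n r k))) + (weight X + (\<Sum>(X, Y)\<in>S. weight X))\<bar>
      \<le> 6 * \<theta> * (weight X + (\<Sum>(X, Y)\<in>S. weight X))"
    using IH(2) step(2) unfolding distrib_left by linarith
  ultimately show ?case unfolding sum eq by blast
qed

text \<open>Pairs of distinct left vertices give the square of the sum minus its diagonal. The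
  \<open>m choose 2\<close> pairs on the right produce the factor \<open>1 - 1 / m\<close>, which is
  \<open>1 - r / (m r)\<close>.\<close>

lemma sum_weight:
  defines "f \<equiv> \<lambda>j. real (k j * (k j - 1))"
  shows "(\<Sum>(X, Y)\<in>rects. weight X)
    = ((\<Sum>j=1..n. f j)^2 - (\<Sum>j=1..n. (f j)^2)) * (real r - 1)^2 / (4 * real (m * r)^2) * (1 - real r / real (m * r))"
proof -
  let ?X = "{X. X \<subseteq> {1..n} \<and> card X = 2}" and ?Y = "{Y. Y \<subseteq> {1..m} \<and> card Y = 2}"
  let ?s = "\<Sum>X\<in>?X. \<Prod>a\<in>X. f a" and ?M = "real (m * r)"
  have m: "0 < m" and r: "0 < r" using mr_pos by auto
  have "card ?Y = m choose 2" using n_subsets[of "{1..m}" 2] by simp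
  moreover have "2 * real (m choose 2) = real m * (real m - 1)"
  proof -
    have "2 * (m choose 2) = m * (m - 1)" by (cases m) (simp_all add: choose_two)
    then have "real (2 * (m choose 2)) = real (m * (m - 1))" by (simp only:)
    then show ?thesis using m by (simp add: of_nat_diff)
  qed
  ultimately have Y: "2 * real (card ?Y) = real m * (real m - 1)" by simp
  have "(\<Sum>(X, Y)\<in>rects. weight X) = (\<Sum>X\<in>?X. \<Sum>Y\<in>?Y. weight X)"
    unfolding rects_def by (rule sum.cartesian_product[symmetric])
  also have "\<dots> = real (card ?Y) * (\<Sum>X\<in>?X. weight X)" by (simp add: sum_distrib_left)
  also have "(\<Sum>X\<in>?X. weight X) = ?s * real ((r * (r - 1))^2) / ?M^4"
    unfolding weight_def f_def by (simp only: sum_distrib_right sum_divide_distrib)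
  also have "real (card ?Y) * (?s * real ((r * (r - 1))^2) / ?M^4)
      = (2 * ?s) * ((2 * real (card ?Y)) * (real r * (real r - 1))^2 / (4 * ?M^4))"
    using r by (simp add: of_nat_diff)
  also have "\<dots> = (2 * ?s) * ((real r - 1)^2 / (4 * ?M^2) * (1 - real r / ?M))"
    unfolding Y using m r by (simp add: field_simps power2_eq_square power4_eq_xxxx)
  finally show ?thesis by (simp add: sum_prod_two_subsets)
qed

text \<open>The main term \<open>l\<close> is at most \<open>r^2 K^2 / 4\<close>, so the accumulated
  error \<open>6 \<theta> T\<close> is at most \<open>24 r^4 K^4 / M\<close>. Replacing the total
  weight \<open>T\<close> by \<open>l\<close> costs the diagonal and the factor
  \<open>1 - r / M\<close>, together at most \<open>r^2 K^2 (K + r) / (4 M)\<close>. Both fit into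
  the constant 25.\<close>

lemma log_probability:
  assumes ne: "bigraphs n r k \<noteq> {}"
  defines "M2 \<equiv> \<Sum>j=1..n. real (k j * (k j - 1))"
  shows "0 < card {B \<in> bigraphs n r k. four_cycles B = {}}" (is "0 < card ?C")
    and "\<bar>ln (real (card {B \<in> bigraphs n r k. four_cycles B = {}}) / real (card (bigraphs n r k)))
       + (real r - 1)^2 * M2^2 / (4 * real (m * r)^2)\<bar>
     \<le> 25 * (real r^4 * real K^4 * (real K + real r)) / real (m * r)"
proof -
  define M where "M = real (m * r)"
  define f where "f = (\<lambda>j. real (k j * (k j - 1)))"
  define Q where "Q = (\<Sum>j=1..n. (f j)^2)"
  define T where "T = (\<Sum>(X, Y)\<in>rects. weight X)"
  define l where "l = (real r - 1)^2 * M2^2 / (4 * M^2)"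
  have M: "0 < M" unfolding M_def using mr_pos by (simp only: of_nat_0_less_iff)
  have th: "\<theta> = 16 * (real K * real r)^2 / M" by (simp add: \<theta>_eq M_def)
  have r1: "0 \<le> real r - 1" "(real r - 1)^2 \<le> real r^2" "1 \<le> real r" "1 \<le> real K"
    using r_ge K_ge by (auto intro: power_mono)
  have m1: "1 \<le> m" using mr_pos by (cases m) auto
  then have rM: "0 \<le> real r / M" "real r / M \<le> 1" using r1 by (auto simp: divide_le_eq M_def)
  note L = log_count[OF finite_rects order_refl ne]
  show pos: "0 < card ?C" using L by (simp add: graphs_rects)
  have L: "\<bar>ln (real (card ?C)) - ln (real (card (bigraphs n r k))) + T\<bar> \<le> 6 * \<theta> * T"
    using L by (simp add: graphs_rects T_def)
  have "0 < card (bigraphs n r k)" using ne finite_bigraphs by (simp add: card_gt_0_iff)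
  then have ln: "ln (real (card ?C) / real (card (bigraphs n r k))) = ln (real (card ?C)) - ln (real (card (bigraphs n r k)))"
    using pos by (simp add: ln_div)
  have f0: "0 \<le> f j" for j by (simp add: f_def)
  have fK: "f j \<le> real K * real (k j)" "f j \<le> real K * real K" if "j \<in> {1..n}" for j
  proof -
    have "k j * (k j - 1) \<le> K * k j" "k j * (k j - 1) \<le> K * K"
      using k_le[OF that] mult_mono[of "k j - 1" K "k j" "k j"] mult_mono[of "k j" K "k j - 1" K] by (auto simp: mult.commute)
    then show "f j \<le> real K * real (k j)" "f j \<le> real K * real K"
      unfolding f_def by (simp_all only: of_nat_le_iff flip: of_nat_mult)
  qed
  have sumk: "(\<Sum>j=1..n. real (k j)) = M" by (simp only: M_def sum_k flip: of_nat_sum)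
  have M2: "0 \<le> M2" "M2 \<le> real K * M"
  proof -
    show "0 \<le> M2" unfolding M2_def by (intro sum_nonneg) auto
    have "M2 \<le> (\<Sum>j=1..n. real K * real (k j))"
      unfolding M2_def using fK(1) by (intro sum_mono) (simp add: f_def)
    then show "M2 \<le> real K * M" by (simp only: sumk flip: sum_distrib_left)
  qed
  have Q: "0 \<le> Q" "Q \<le> real K^3 * M"
  proof -
    show "0 \<le> Q" unfolding Q_def by (intro sum_nonneg) auto
    have "Q \<le> (\<Sum>j=1..n. (real K * real K) * f j)"
      unfolding Q_def power2_eq_square using fK(2) f0 by (intro sum_mono mult_right_mono) auto
    also have "\<dots> = (real K * real K) * M2" by (simp only: f_def M2_def flip: sum_distrib_left)
    also have "\<dots> \<le> (real K * real K) * (real K * M)" using M2 by (intro mult_left_mono) auto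
    finally show "Q \<le> real K^3 * M" by (simp add: power3_eq_cube mult_ac)
  qed
  have l: "0 \<le> l" "l \<le> real r^2 * real K^2 / 4"
  proof -
    show "0 \<le> l" unfolding l_def by simp
    have "(real r - 1)^2 * M2^2 \<le> real r^2 * (real K * M)^2"
      using r1 M2 by (intro mult_mono power_mono) auto
    then have "l \<le> real r^2 * (real K * M)^2 / (4 * M^2)"
      unfolding l_def by (intro divide_right_mono) auto
    also have "\<dots> = real r^2 * real K^2 / 4" using M by (simp add: power_mult_distrib)
    finally show "l \<le> real r^2 * real K^2 / 4" .
  qed
  \<comment> \<open>The diagonal contribution, small because
    \<open>Q \<le> K^2 M2 \<le> K^3 M\<close>.\<close>
  define g where "g = Q * (real r - 1)^2 / (4 * M^2)"
  have g: "0 \<le> g" "g \<le> real r^2 * real K^3 / (4 * M)"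
  proof -
    show "0 \<le> g" unfolding g_def using Q by simp
    have "Q * (real r - 1)^2 \<le> (real K^3 * M) * real r^2"
      using r1 Q by (intro mult_mono) auto
    then have "g \<le> (real K^3 * M) * real r^2 / (4 * M^2)"
      unfolding g_def by (intro divide_right_mono) auto
    also have "\<dots> = real r^2 * real K^3 / (4 * M)" using M by (simp add: power2_eq_square)
    finally show "g \<le> real r^2 * real K^3 / (4 * M)" .
  qed
  have T: "T = (l - g) * (1 - real r / M)"
  proof -
    have "l - g = (M2^2 - Q) * (real r - 1)^2 / (4 * M^2)"
      unfolding l_def g_def by (simp add: left_diff_distrib diff_divide_distrib mult.commute)
    then show ?thesis unfolding T_def sum_weight M_def M2_def Q_def f_def by (simp only:)
  qed
  have T0: "0 \<le> T" unfolding T_def by (intro sum_nonneg) (auto simp: weight_nonneg)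
  have gr: "0 \<le> g * (1 - real r / M)" "g * (1 - real r / M) \<le> g"
    using g rM by (auto intro: mult_left_le)
  have lr: "0 \<le> l * (real r / M)" using l rM by (intro mult_nonneg_nonneg) auto
  have Teq: "T = l - l * (real r / M) - g * (1 - real r / M)"
    unfolding T by (simp only: left_diff_distrib right_diff_distrib mult_1_right)
  have Tl: "\<bar>T - l\<bar> \<le> l * (real r / M) + g" "T \<le> l"
    using Teq gr lr by linarith+
  have "l * (real r / M) \<le> real r^2 * real K^2 / 4 * (real r / M)"
    using l rM by (intro mult_right_mono) auto
  then have e1: "\<bar>T - l\<bar> \<le> real r^2 * real K^2 / 4 * (real r / M) + real r^2 * real K^3 / (4 * M)"
    using Tl g by linarith
  have e2: "6 * \<theta> * T \<le> 6 * \<theta> * (real r^2 * real K^2 / 4)"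
    using \<theta>_nonneg Tl(2) l by (intro mult_left_mono) auto
  have "\<bar>ln (real (card ?C) / real (card (bigraphs n r k))) + l\<bar> \<le>
      6 * \<theta> * (real r^2 * real K^2 / 4) + (real r^2 * real K^2 / 4 * (real r / M) + real r^2 * real K^3 / (4 * M))"
    unfolding ln using L e1 e2 by linarith
  also have "\<dots> = (24 * (real r^4 * real K^4) + real r^2 * real K^2 * (real K + real r) / 4) / M"
    using M by (simp add: th power2_eq_square power3_eq_cube power4_eq_xxxx field_simps)
  also have "\<dots> \<le> (24 * (real r^4 * real K^4 * (real K + real r)) + real r^4 * real K^4 * (real K + real r)) / M"
  proof (intro divide_right_mono add_mono)
    show "24 * (real r^4 * real K^4) \<le> 24 * (real r^4 * real K^4 * (real K + real r))"
      using r1 by simp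
    have "real r^2 * real K^2 * (real K + real r) / 4 \<le> real r^2 * real K^2 * (real K + real r)"
      using r1 by simp
    also have "\<dots> \<le> real r^4 * real K^4 * (real K + real r)"
      using r1 by (intro mult_right_mono mult_mono power_increasing) auto
    finally show "real r^2 * real K^2 * (real K + real r) / 4 \<le> real r^4 * real K^4 * (real K + real r)" .
  qed (use M in simp)
  also have "\<dots> = 25 * (real r^4 * real K^4 * (real K + real r)) / M" by simp
  finally show "\<bar>ln (real (card ?C) / real (card (bigraphs n r k))) + (real r - 1)^2 * M2^2 / (4 * real (m * r)^2)\<bar>
     \<le> 25 * (real r^4 * real K^4 * (real K + real r)) / real (m * r)"
    unfolding l_def M_def .
qed

end

section \<open>Girth and asymptotics\<close>

lemma copies_four_cycle:
  assumes "has_copy a b B" "2 \<le> a" "2 \<le> b"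
  shows "four_cycles B \<noteq> {}"
proof -
  obtain X Y where XY: "card X = a" "card Y = b" "X \<times> Y \<subseteq> B" using assms(1) by (auto simp: copies_def)
  obtain X' where X': "X' \<subseteq> X" "card X' = 2" using XY assms(2) by (metis obtain_subset_with_card_n)
  obtain Y' where Y': "Y' \<subseteq> Y" "card Y' = 2" using XY assms(3) by (metis obtain_subset_with_card_n)
  have "X' \<times> Y' \<subseteq> B" using XY X' Y' by blast
  then have "(X', Y') \<in> four_cycles B" using X' Y' by (simp add: copies_def)
  then show ?thesis by blast
qed

text \<open>A copy of \<open>K_{3,2}\<close> or \<open>K_{2,3}\<close> contains a 4-cycle, and the
  conditions on several 4-cycles hold vacuously in their absence. The bound on the number of
  4-cycles then amounts to \<open>N2\<close> being nonnegative.\<close>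

lemma C0_eq: "C0 n r k = {B \<in> bigraphs n r k. four_cycles B = {}}"
proof -
  \<comment> \<open>For the degree sum 0 this relies on the convention
    \<open>ln 0 = 0\<close>.\<close>
  have "0 \<le> ln (real (deg_sum n k))"
    by (cases "deg_sum n k = 0") auto
  then have "0 \<le> \<lceil>ln (real (deg_sum n k))\<rceil>" by linarith
  then have "0 \<le> N2 n r k" unfolding N2_def by (simp only: le_max_iff_disj zero_le_mult_iff) simp
  then have "B \<in> bigraphs_plus n r k" if "B \<in> bigraphs n r k" "four_cycles B = {}" for B
  proof -
    have "copies 3 2 B = {}" "copies 2 3 B = {}"
      using that(2) copies_four_cycle[of 3 2 B] copies_four_cycle[of 2 3 B] by auto
    then show ?thesis using that \<open>0 \<le> N2 n r k\<close> unfolding bigraphs_plus_def by simp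
  qed
  moreover have "bigraphs_plus n r k \<subseteq> bigraphs n r k" unfolding bigraphs_plus_def by blast
  ultimately show ?thesis unfolding C0_def by blast
qed

section \<open>Short cycles in bipartite graphs\<close>

lemma adjacent_isl: "adjacent B u v \<Longrightarrow> isl u \<longleftrightarrow> \<not> isl v"
  by (auto simp: adjacent_def)

lemma four_cycles_Inl:
  assumes "adjacent B (Inl a) v" "adjacent B v w" "adjacent B w z" "adjacent B z (Inl a)" "Inl a \<noteq> w" "v \<noteq> z"
  shows "four_cycles B \<noteq> {}"
proof -
  obtain i j i' where "v = Inr i" "w = Inl j" "z = Inr i'" "(a, i) \<in> B" "(j, i) \<in> B" "(j, i') \<in> B" "(a, i') \<in> B"
    using assms by (auto simp: adjacent_def)
  then have "({a, j}, {i, i'}) \<in> four_cycles B" using assms by (auto simp: copies_def)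
  then show ?thesis by blast
qed

text \<open>The sides alternate along a cycle, which rules out the lengths 3 and 5; a cycle of
  length 4 is a copy of \<open>K_{2,2}\<close>.\<close>

lemma girth_ge_6:
  assumes "four_cycles B = {}"
  shows "6 \<le> girth B"
  unfolding girth_def
proof (rule INF_greatest)
  fix p assume "p \<in> {p. is_cycle B p}"
  then have p: "3 \<le> length p" "distinct p"
    "\<And>t. t < length p \<Longrightarrow> adjacent B (p ! t) (p ! (Suc t mod length p))" by (auto simp: is_cycle_def)
  have adj: "adjacent B (p ! t) (p ! t')" if "t < length p" "t' = Suc t mod length p" for t t'
    using p(3)[OF that(1)] that(2) by simp
  have "length p \<noteq> 3"
  proof
    assume l: "length p = 3"
    have "adjacent B (p ! 0) (p ! 1)" "adjacent B (p ! 1) (p ! 2)" "adjacent B (p ! 2) (p ! 0)"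
      by (rule adj; simp add: l)+
    then show False using adjacent_isl by blast
  qed
  moreover have "length p \<noteq> 5"
  proof
    assume l: "length p = 5"
    have "adjacent B (p ! 0) (p ! 1)" "adjacent B (p ! 1) (p ! 2)" "adjacent B (p ! 2) (p ! 3)"
      "adjacent B (p ! 3) (p ! 4)" "adjacent B (p ! 4) (p ! 0)"
      by (rule adj; simp add: l)+
    then show False using adjacent_isl by blast
  qed
  moreover have "length p \<noteq> 4"
  proof
    assume l: "length p = 4"
    have d: "p ! 0 \<noteq> p ! 2" "p ! 1 \<noteq> p ! 3" using p(2) l by (simp_all add: nth_eq_iff_index_eq)
    have a: "adjacent B (p ! 0) (p ! 1)" "adjacent B (p ! 1) (p ! 2)" "adjacent B (p ! 2) (p ! 3)" "adjacent B (p ! 3) (p ! 0)"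
      by (rule adj; simp add: l)+
    show False
    proof (cases "p ! 0")
      case (Inl j)
      then show False using four_cycles_Inl[of B j "p ! 1" "p ! 2" "p ! 3"] a d assms by simp
    next
      \<comment> \<open>A cycle that starts on the right is rotated by one position.\<close>
      case (Inr i)
      then obtain j where j: "p ! 1 = Inl j" using a(1) by (auto simp: adjacent_def)
      then show False using four_cycles_Inl[of B j "p ! 2" "p ! 3" "p ! 0"] a d assms by simp
    qed
  qed
  ultimately have "6 \<le> length p" using p(1) by linarith
  then show "6 \<le> enat (length p)" by (simp add: numeral_eq_enat)
qed

section \<open>Passage to large \<open>n\<close> along the index set\<close>

lemma eventually_along: "eventually P (along I) \<longleftrightarrow> eventually (\<lambda>n. n \<in> I \<longrightarrow> P n) sequentially"
  by (simp add: along_def eventually_inf_principal)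

text \<open>For \<open>K, r \<ge> 1\<close> one has \<open>(K r)^2 \<le> r^4 K^4 (K + r)\<close>,
  and the latter is at most \<open>M / 160\<close> by assumption. If \<open>K\<close> were 0, all
  degrees and hence \<open>M\<close> would vanish.\<close>

lemma sparse_degree_sequenceI:
  assumes r: "3 \<le> r" "r dvd deg_sum n k" and M: "0 < deg_sum n k" and K: "K = deg_max n k"
    and small: "real r^4 * real K^4 * (real K + real r) \<le> 1 / 160 * real (deg_sum n k)"
  shows "sparse_degree_sequence n (deg_sum n k div r) r K k"
proof -
  let ?M = "deg_sum n k"
  have m: "?M div r * r = ?M" using r(2) by simp
  have k_le: "k j \<le> K" if "j \<in> {1..n}" for j
    unfolding K deg_max_def using that by (intro Max_ge) auto
  have K1: "1 \<le> K"
  proof (rule ccontr)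
    assume "\<not> 1 \<le> K"
    then have "k j = 0" if "j \<in> {1..n}" for j using k_le[OF that] by simp
    then have "?M = 0" by (simp add: deg_sum_def)
    then show False using M by simp
  qed
  have "(K * r)^2 * 1 \<le> (K * r)^4 * (K + r)"
    using K1 r by (intro mult_mono power_increasing) auto
  then have "real ((K * r)^2) \<le> real ((K * r)^4 * (K + r))" by (simp only: of_nat_le_iff mult_1_right)
  also have "\<dots> = real r^4 * real K^4 * (real K + real r)" by (simp add: power_mult_distrib mult_ac)
  finally have "160 * real ((K * r)^2) \<le> real ?M" using small by linarith
  then have "real (160 * (K * r)^2) \<le> real ?M" by (simp only: of_nat_mult of_nat_numeral)
  then have "160 * (K * r)^2 \<le> ?M" by (simp only: of_nat_le_iff)
  then show ?thesis
    using r k_le K1 by unfold_locales (simp_all only: m, simp_all add: deg_sum_def)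
qed

theorem corollary3p5:
  fixes r :: "nat \<Rightarrow> nat" and k :: "nat \<Rightarrow> nat \<Rightarrow> nat"
    and kmax M M2 :: "nat \<Rightarrow> nat" and I :: "nat set" and err :: "nat \<Rightarrow> real"
  assumes r_ge: "\<And>n. n \<ge> 3 \<Longrightarrow> r n \<ge> 3"
    and kmax: "\<And>n. kmax n = deg_max n (k n)"
    and M: "\<And>n. M n = deg_sum n (k n)"
    and M2: "\<And>n. M2 n = deg_sum2 n (k n)"
    and I: "I = {n. n \<ge> 3 \<and> r n dvd M n}"
    and err: "\<And>n. err n = real (r n)^4 * real (kmax n)^4 * (real (kmax n) + real (r n))"
    and I_infinite: "infinite I"
    and M_lim: "filterlim M at_top (along I)"
    and err_small: "err \<in> o[along I](\<lambda>n. real (M n))"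
  shows "(\<forall>n\<in>I. \<forall>B\<in>bigraphs n (r n) (k n). four_cycles B = {} \<longrightarrow> girth B \<ge> 6) \<and>
    (\<exists>\<epsilon> \<in> O[along I](\<lambda>n. err n / real (M n)).
      \<forall>\<^sub>F n in along I.
        bigraphs n (r n) (k n) \<noteq> {} \<and>
        measure_pmf.prob (pmf_of_set (bigraphs n (r n) (k n))) {B. four_cycles B = {}}
          = real (card (C0 n (r n) (k n))) / real (card (bigraphs n (r n) (k n))) \<and>
        real (card (C0 n (r n) (k n))) / real (card (bigraphs n (r n) (k n)))
          = exp (- ((real (r n) - 1)^2 * real (M2 n)^2) / (4 * real (M n)^2) + \<epsilon> n))"
proof -
  define ratio where "ratio = (\<lambda>n. real (card (C0 n (r n) (k n))) / real (card (bigraphs n (r n) (k n))))"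
  define lam where "lam = (\<lambda>n. (real (r n) - 1)^2 * real (M2 n)^2 / (4 * real (M n)^2))"
  \<comment> \<open>With this choice the exponential formula is an identity wherever the ratio is
    positive; only the size of \<open>\<epsilon>\<close> remains to be bounded.\<close>
  define \<epsilon> where "\<epsilon> = (\<lambda>n. ln (ratio n) + lam n)"
  have ev: "\<forall>\<^sub>F n in along I. bigraphs n (r n) (k n) \<noteq> {} \<and>
      measure_pmf.prob (pmf_of_set (bigraphs n (r n) (k n))) {B. four_cycles B = {}} = ratio n \<and>
      0 < ratio n \<and> \<bar>\<epsilon> n\<bar> \<le> 25 * \<bar>err n / real (M n)\<bar>"
  proof -
    have "\<forall>\<^sub>F n in along I. n \<in> I" by (simp add: eventually_along)
    moreover have "\<forall>\<^sub>F n in along I. 1 \<le> M n" using M_lim by (simp add: filterlim_at_top)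
    \<comment> \<open>The little-o assumption allows any positive constant; \<open>1 / 160\<close>
      is the one demanded by \<open>sparse_degree_sequenceI\<close>.\<close>
    moreover have "\<forall>\<^sub>F n in along I. norm (err n) \<le> 1 / 160 * norm (real (M n))"
      by (rule landau_o.smallD[OF err_small]) simp
    ultimately show ?thesis
    proof eventually_elim
      case (elim n)
      let ?B = "bigraphs n (r n) (k n)" and ?M = "deg_sum n (k n)"
      have r3: "3 \<le> r n" and dvd: "r n dvd ?M" using elim(1) r_ge by (auto simp: I M)
      have e0: "0 \<le> err n" by (simp add: err)
      have "real (r n)^4 * real (kmax n)^4 * (real (kmax n) + real (r n)) \<le> 1 / 160 * real ?M"
        using elim(3) e0 unfolding err M by simp
      then interpret sparse_degree_sequence n "?M div r n" "r n" "kmax n" "k n"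
        using elim(2) r3 dvd by (intro sparse_degree_sequenceI) (auto simp: M kmax)
      have m: "?M div r n * r n = M n" using dvd by (simp add: M)
      \<comment> \<open>The existence of a graph requires \<open>K \<le> m\<close>, which follows
        from \<open>K r \<le> (K r)^2 \<le> m r\<close>.\<close>
      have "kmax n \<le> ?M div r n"
      proof -
        have "kmax n * r n * 1 \<le> (kmax n * r n) * (kmax n * r n)"
          using K_ge r3 by (intro mult_le_mono) auto
        then have "kmax n * r n \<le> ?M div r n * r n"
          using sparse unfolding power2_eq_square by linarith
        then show ?thesis using r3 by simp
      qed
      then have ne: "?B \<noteq> {}" by (rule bigraphs_nonempty)
      have M2': "(\<Sum>j=1..n. real (k n j * (k n j - 1))) = real (M2 n)" by (simp add: M2 deg_sum2_def)
      have C0: "C0 n (r n) (k n) = {B \<in> ?B. four_cycles B = {}}" by (rule C0_eq)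
      have "measure_pmf.prob (pmf_of_set ?B) {B. four_cycles B = {}} = ratio n"
        unfolding ratio_def C0 using measure_pmf_of_set[OF ne finite_bigraphs]
        by (simp add: Int_def)
      moreover have "0 < ratio n"
        using log_probability(1)[OF ne] ne finite_bigraphs unfolding ratio_def C0
        by (simp add: card_gt_0_iff)
      moreover have "\<bar>\<epsilon> n\<bar> \<le> 25 * \<bar>err n / real (M n)\<bar>"
      proof -
        have "\<bar>\<epsilon> n\<bar> \<le> 25 * err n / real (M n)"
          using log_probability(2)[OF ne] unfolding \<epsilon>_def ratio_def lam_def C0 M2' m err .
        then show ?thesis using e0 by simp
      qed
      ultimately show ?case using ne by blast
    qed
  qed
  have "\<epsilon> \<in> O[along I](\<lambda>n. err n / real (M n))"
    by (rule landau_o.bigI[of 25]) (use ev in \<open>auto elim!: eventually_mono\<close>)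
  moreover have "\<forall>\<^sub>F n in along I. bigraphs n (r n) (k n) \<noteq> {} \<and>
        measure_pmf.prob (pmf_of_set (bigraphs n (r n) (k n))) {B. four_cycles B = {}}
          = real (card (C0 n (r n) (k n))) / real (card (bigraphs n (r n) (k n))) \<and>
        real (card (C0 n (r n) (k n))) / real (card (bigraphs n (r n) (k n)))
          = exp (- ((real (r n) - 1)^2 * real (M2 n)^2) / (4 * real (M n)^2) + \<epsilon> n)"
    using ev
  proof eventually_elim
    case (elim n)
    then have "exp (- lam n + \<epsilon> n) = ratio n" by (simp add: \<epsilon>_def)
    then show ?case using elim by (simp add: ratio_def lam_def)
  qed
  ultimately show ?thesis using girth_ge_6 by blast
qed

end
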